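(* For every proper geodesic metrisable pointed coarse space $(X,\xi)$ in $\mathscr{C}$, the map $\omega_{(X,\xi)}\colon\sigma(X,\xi)\to\iota(X,\xi)$, $[s]_{\equiv^{\sigma}_{X,\xi}}\mapsto[{}^{*}s(i)]_{\equiv^{\iota}_{X,\xi}}$ (where $i\in{}^{*}\mathbb{N}\setminus\mathbb{N}$ is arbitrary), is bijective.
   Context: A coarse structure on a set $X$ is an ideal $\mathcal{C}_X$ of the poset $(\mathcal{P}(X\times X),\subseteq)$ containing the diagonal and closed under composition $E\circ F=\{(x,y)\mid \exists z\in X,\ (x,z)\in E,\ (z,y)\in F\}$ and inversion; its elements are called controlled sets. A coarse space is a set with a coarse structure. $B\subseteq X$ is bounded if $B\times B\in\mathcal{C}_X$. A map between coarse spaces is proper if preimages of bounded sets are bounded, bornologous if $(f\times f)(E)$ is controlled for each controlled $E$, and coarse if proper and bornologous. $\mathbf{Coarse}_*$ is the category of pointed coarse spaces and basepoint-preserving coarse maps. A metric $d_X$ on $X$ induces the bounded coarse structure $\{E\subseteq X\times X\mid\sup d_X(E)<+\infty\}$. A coarse space is proper geodesic metrisable if its coarse structure is the bounded coarse structure of a metric $d_X$ that is proper (closed bounded sets are compact) and geodesic (any two points are joined by a path isometric to an interval of length equal to their distance). A coarse sequence in $(X,\xi)$ is a coarse map $s\colon(\mathbb{N},0)\to(X,\xi)$, where $\mathbb{N}$ has the bounded coarse structure of $|i-j|$. $S(X,\xi)$ is the set of coarse sequences in $(X,\xi)$. For $s,t\in S(X,\xi)$, $s\equiv^{\sigma}_{X,\xi}t$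 if there is a finite sequence $s=s_0,\dots,s_n=t$ in $S(X,\xi)$ such that for each $i<n$ one of $s_i,s_{i+1}$ is a subsequence of the other. Put $\sigma(X,\xi):=S(X,\xi)/{\equiv^{\sigma}_{X,\xi}}$. Nonstandard setting: $\mathscr{C}$ is a fixed small full subcategory of $\mathbf{Coarse}_*$; $\mathbb{U}$ (the standard universe) is a transitive set containing $\mathscr{C}$ and all classical objects needed, with respect to which the needed set-theoretic formulae are absolute; ${}^{*}\colon\mathbb{U}\hookrightarrow{}^{*}\mathbb{U}$, $x\mapsto{}^{*}x$, is a fixed sufficiently saturated elementary extension (families of internal sets indexed by a set in $\mathbb{U}$ and having the finite intersection property have nonempty intersection). Points $x$ of a standard space are identified with ${}^{*}x$. "Standard" means belonging to $\mathbb{U}$. For a standard coarse space $X$ and $x,y\in{}^{*}X$, $x\sim_X y$ iff $(x,y)\in{}^{*}E$ for some (standard) $E\in\mathcal{C}_X$. $\operatorname{INF}(X,\xi):=\{x\in{}^{*}X\mid x\not\sim_X\xi\}$. For $x,y\in\operatorname{INF}(X,\xi)$, $x\equiv^{\iota}_{X,\xi}y$ if there is an internal hyperfinite sequence $\{x_i\}_{i\le n}$ ($n\in{}^{*}\mathbb{N}$) in $\operatorname{INF}(X,\xi)$ with $x_0=x$, $x_n=y$ and $x_i\sim_X x_{i+1}$ for all $i<n$. Put $\iota(X,\xi):=\operatorname{INF}(X,\xi)/{\equiv^{\iota}_{X,\xi}}$. The map $\omega_{(X,\xi)}$ is well-defined for every $(X,\xi)$ in $\mathscr{C}$, independently of the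 choice of $s$ in its class and of the infinite index $i$. *)

theory Defs
  imports "HOL-Analysis.Analysis"
begin

section \<open>Coarse spaces\<close>

definition coarse_structure :: "'a set \<Rightarrow> ('a \<times> 'a) set set \<Rightarrow> bool" where
  "coarse_structure X C \<longleftrightarrow>
     C \<subseteq> Pow (X \<times> X) \<and>
     (\<forall>E\<in>C. \<forall>F. F \<subseteq> E \<longrightarrow> F \<in> C) \<and>
     (\<forall>E\<in>C. \<forall>F\<in>C. E \<union> F \<in> C) \<and>
     Id_on X \<in> C \<and>
     (\<forall>E\<in>C. \<forall>F\<in>C. E O F \<in> C) \<and>
     (\<forall>E\<in>C. E\<inverse> \<in> C)"

definition coarse_bounded :: "'a set \<Rightarrow> ('a \<times> 'a) set set \<Rightarrow> 'a set \<Rightarrow> bool" where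
  "coarse_bounded X C B \<longleftrightarrow> B \<subseteq> X \<and> B \<times> B \<in> C"

definition coarse_map ::
  "'a set \<Rightarrow> ('a \<times> 'a) set set \<Rightarrow> 'b set \<Rightarrow> ('b \<times> 'b) set set \<Rightarrow> ('a \<Rightarrow> 'b) \<Rightarrow> bool" where
  "coarse_map X C Y D f \<longleftrightarrow>
     f \<in> X \<rightarrow> Y \<and>
     (\<forall>B. coarse_bounded Y D B \<longrightarrow> coarse_bounded X C (f -` B \<inter> X)) \<and>
     (\<forall>E\<in>C. map_prod f f ` E \<in> D)"

definition bounded_coarse :: "'a set \<Rightarrow> ('a \<Rightarrow> 'a \<Rightarrow> real) \<Rightarrow> ('a \<times> 'a) set set" where
  "bounded_coarse X d = {E. E \<subseteq> X \<times> X \<and> bdd_above ((\<lambda>(x, y). d x y) ` E)}"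

definition proper_metric :: "'a set \<Rightarrow> ('a \<Rightarrow> 'a \<Rightarrow> real) \<Rightarrow> bool" where
  "proper_metric X d \<longleftrightarrow>
     (\<forall>S. closedin (Metric_space.mtopology X d) S \<and> Metric_space.mbounded X d S
        \<longrightarrow> compactin (Metric_space.mtopology X d) S)"

definition geodesic_metric :: "'a set \<Rightarrow> ('a \<Rightarrow> 'a \<Rightarrow> real) \<Rightarrow> bool" where
  "geodesic_metric X d \<longleftrightarrow>
     (\<forall>x\<in>X. \<forall>y\<in>X. \<exists>g :: real \<Rightarrow> 'a.
        g 0 = x \<and> g (d x y) = y \<and> g \<in> {0..d x y} \<rightarrow> X \<and>
        (\<forall>s\<in>{0..d x y}. \<forall>t\<in>{0..d x y}. d (g s) (g t) = \<bar>s - t\<bar>))"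

definition proper_geodesic_metrisable :: "'a set \<Rightarrow> ('a \<times> 'a) set set \<Rightarrow> bool" where
  "proper_geodesic_metrisable X C \<longleftrightarrow>
     (\<exists>d. Metric_space X d \<and> proper_metric X d \<and> geodesic_metric X d \<and> C = bounded_coarse X d)"


section \<open>Coarse sequences and \<open>\<sigma>\<close>\<close>

definition nat_coarse :: "(nat \<times> nat) set set" where
  "nat_coarse = bounded_coarse UNIV (\<lambda>i j. \<bar>real i - real j\<bar>)"

definition coarse_seqs :: "'a set \<Rightarrow> ('a \<times> 'a) set set \<Rightarrow> 'a \<Rightarrow> (nat \<Rightarrow> 'a) set" where
  "coarse_seqs X C \<xi> = {s. coarse_map UNIV nat_coarse X C s \<and> s 0 = \<xi>}"

definition is_subseq :: "(nat \<Rightarrow> 'a) \<Rightarrow> (nat \<Rightarrow> 'a) \<Rightarrow> bool" where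
  "is_subseq s t \<longleftrightarrow> (\<exists>r. strict_mono r \<and> s = t \<circ> r)"

definition sigma_rel ::
  "'a set \<Rightarrow> ('a \<times> 'a) set set \<Rightarrow> 'a \<Rightarrow> ((nat \<Rightarrow> 'a) \<times> (nat \<Rightarrow> 'a)) set" where
  "sigma_rel X C \<xi> =
     {(s, t). \<exists>n (u :: nat \<Rightarrow> nat \<Rightarrow> 'a).
        u 0 = s \<and> u n = t \<and> (\<forall>i\<le>n. u i \<in> coarse_seqs X C \<xi>) \<and>
        (\<forall>i<n. is_subseq (u i) (u (Suc i)) \<or> is_subseq (u (Suc i)) (u i))}"

definition coarse_sigma :: "'a set \<Rightarrow> ('a \<times> 'a) set set \<Rightarrow> 'a \<Rightarrow> (nat \<Rightarrow> 'a) set set" where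
  "coarse_sigma X C \<xi> = coarse_seqs X C \<xi> // sigma_rel X C \<xi>"


section \<open>The language of set theory\<close>

text \<open>First-order formulae over one binary relation; variables are named by natural numbers.\<close>

datatype fm = Mem nat nat | Eq nat nat | Neg fm | Conj fm fm | Ex nat fm

primrec sat :: "('m \<Rightarrow> 'm \<Rightarrow> bool) \<Rightarrow> (nat \<Rightarrow> 'm) \<Rightarrow> fm \<Rightarrow> bool" where
  "sat m e (Mem i j) \<longleftrightarrow> m (e i) (e j)"
| "sat m e (Eq i j) \<longleftrightarrow> e i = e j"
| "sat m e (Neg p) \<longleftrightarrow> \<not> sat m e p"
| "sat m e (Conj p q) \<longleftrightarrow> sat m e p \<and> sat m e q"
| "sat m e (Ex i p) \<longleftrightarrow> (\<exists>a. sat m (e(i := a)) p)"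

definition members :: "('m \<Rightarrow> 'm \<Rightarrow> bool) \<Rightarrow> 'm \<Rightarrow> 'm set" where
  "members m a = {z. m z a}"

text \<open>\<open>is_opair m p x y\<close>: \<open>p\<close> is the Kuratowski pair \<open>(x, y)\<close> in the structure with membership \<open>m\<close>.\<close>

definition is_opair :: "('m \<Rightarrow> 'm \<Rightarrow> bool) \<Rightarrow> 'm \<Rightarrow> 'm \<Rightarrow> 'm \<Rightarrow> bool" where
  "is_opair m p x y \<longleftrightarrow>
     (\<exists>u v. members m u = {x} \<and> members m v = {x, y} \<and> members m p = {u, v})"

text \<open>The relation whose graph is the element \<open>a\<close> of the structure.\<close>

definition rel_of :: "('m \<Rightarrow> 'm \<Rightarrow> bool) \<Rightarrow> 'm \<Rightarrow> ('m \<times> 'm) set" where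
  "rel_of m a = {(x, y). \<exists>p. is_opair m p x y \<and> m p a}"

definition app :: "('m \<times> 'm) set \<Rightarrow> 'm \<Rightarrow> 'm" where
  "app R x = (THE y. (x, y) \<in> R)"


section \<open>The standard universe\<close>

text \<open>
  By Mostowski collapse, a transitive set is the same thing as a type with a well-founded
  extensional relation \<open>mem\<close>; the elements of the type are the standard sets. The assumption
  \<open>subset_closed\<close> speaks about all subsets in the sense of HOL, so notions such as
  ``power set'', ``coarse structure'' and ``finite'' are absolute. Closure under
  power sets is not required: the classical objects attached to a space are subsets of sets built
  from the space and the natural numbers by products. So both the stages \<open>V\<^sub>\<lambda>\<close> (for limit
  \<open>\<lambda> > \<omega>\<close>) and the sets \<open>H(\<kappa>)\<close> (for uncountable \<open>\<kappa>\<close>) are admissible.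
\<close>

locale transitive_universe =
  fixes mem :: "'u \<Rightarrow> 'u \<Rightarrow> bool"
  assumes well_founded: "wf {(x, y). mem x y}"
    and extensional: "members mem a = members mem b \<Longrightarrow> a = b"
    and pairing: "\<exists>c. members mem c = {a, b}"
    and union: "\<exists>c. members mem c = (\<Union>b \<in> members mem a. members mem b)"
    and subset_closed: "A \<subseteq> members mem a \<Longrightarrow> \<exists>c. members mem c = A"
begin

definition is_standard :: "'u set \<Rightarrow> bool" where
  "is_standard A \<longleftrightarrow> (\<exists>a. members mem a = A)"

text \<open>\<open>code A\<close> and \<open>code_rel E\<close> are the elements of the universe that represent \<open>A\<close> and \<open>E\<close>;
  they are meaningful only if \<open>A\<close>, respectively \<open>pairs E\<close>, is standard.\<close>

definition code :: "'u set \<Rightarrow> 'u" where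
  "code A = (THE a. members mem a = A)"

definition opair :: "'u \<Rightarrow> 'u \<Rightarrow> 'u" where
  "opair x y = (THE p. is_opair mem p x y)"

definition pairs :: "('u \<times> 'u) set \<Rightarrow> 'u set" where
  "pairs E = (\<lambda>(x, y). opair x y) ` E"

definition code_rel :: "('u \<times> 'u) set \<Rightarrow> 'u" where
  "code_rel E = code (pairs E)"

text \<open>Von Neumann numerals.\<close>

primrec num :: "nat \<Rightarrow> 'u" where
  "num 0 = code {}"
| "num (Suc n) = code (insert (num n) (members mem (num n)))"

end

locale standard_universe = transitive_universe mem
  for mem :: "'u \<Rightarrow> 'u \<Rightarrow> bool" +
  assumes infinity: "is_standard (range num)"
    and products: "is_standard A \<Longrightarrow> is_standard B \<Longrightarrow> is_standard (pairs (A \<times> B))"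
begin

definition code_space :: "'u set \<times> ('u \<times> 'u) set set \<times> 'u \<Rightarrow> 'u" where
  "code_space = (\<lambda>(X, C, \<xi>). opair (opair (code X) (code (code_rel ` C))) \<xi>)"

text \<open>A full subcategory of the category of pointed coarse spaces is determined by its class of
  objects; it is standard if this class, together with its constituents, is.\<close>

definition standard_full_subcategory ::
  "('u set \<times> ('u \<times> 'u) set set \<times> 'u) set \<Rightarrow> bool" where
  "standard_full_subcategory \<C> \<longleftrightarrow>
     (\<forall>(X, C, \<xi>) \<in> \<C>. coarse_structure X C \<and> \<xi> \<in> X \<and>
        is_standard X \<and> (\<forall>E\<in>C. is_standard (pairs E)) \<and> is_standard (code_rel ` C)) \<and>
     is_standard (code_space ` \<C>)"

end


section \<open>Nonstandard extensions\<close>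

text \<open>The saturation assumption concerns families \<open>A\<close> (not necessarily internal) of internal sets,
  indexed by the members of a standard set \<open>I\<close>.\<close>

locale nonstandard_extension = standard_universe mem
  for mem :: "'u \<Rightarrow> 'u \<Rightarrow> bool" +
  fixes smem :: "'v \<Rightarrow> 'v \<Rightarrow> bool" and star :: "'u \<Rightarrow> 'v"
  assumes elementary: "sat smem (star \<circ> e) p \<longleftrightarrow> sat mem e p"
    and saturated:
      "(\<And>F. finite F \<Longrightarrow> F \<subseteq> members mem I \<Longrightarrow> (\<Inter>i\<in>F. members smem (A i)) \<noteq> {}) \<Longrightarrow>
       (\<Inter>i \<in> members mem I. members smem (A i)) \<noteq> {}"
begin

definition star_set :: "'u set \<Rightarrow> 'v set" where
  "star_set A = members smem (star (code A))"

definition star_rel :: "('u \<times> 'u) set \<Rightarrow> ('v \<times> 'v) set" where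
  "star_rel E = rel_of smem (star (code_rel E))"

definition star_seq :: "(nat \<Rightarrow> 'u) \<Rightarrow> 'v \<Rightarrow> 'v" where
  "star_seq s = app (star_rel (range (\<lambda>k. (num k, s k))))"

definition hypernats :: "'v set" where
  "hypernats = star_set (range num)"

definition infinite_hypernats :: "'v set" where
  "infinite_hypernats = hypernats - star ` range num"

definition hle :: "'v \<Rightarrow> 'v \<Rightarrow> bool" where
  "hle i j \<longleftrightarrow> (i, j) \<in> star_rel {(num a, num b) |a b. a \<le> b}"

definition hless :: "'v \<Rightarrow> 'v \<Rightarrow> bool" where
  "hless i j \<longleftrightarrow> (i, j) \<in> star_rel {(num a, num b) |a b. a < b}"

definition hsuc :: "'v \<Rightarrow> 'v" where
  "hsuc = star_seq (\<lambda>k. num (Suc k))"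

definition near :: "('u \<times> 'u) set set \<Rightarrow> 'v \<Rightarrow> 'v \<Rightarrow> bool" where
  "near C x y \<longleftrightarrow> (\<exists>E\<in>C. (x, y) \<in> star_rel E)"

definition inf_points :: "'u set \<Rightarrow> ('u \<times> 'u) set set \<Rightarrow> 'u \<Rightarrow> 'v set" where
  "inf_points X C \<xi> = {x \<in> star_set X. \<not> near C x (star \<xi>)}"

text \<open>The internal set \<open>h\<close> is a function with domain \<open>{i. i \<le> n}\<close>; its value at \<open>i\<close> is
  \<open>app (rel_of smem h) i\<close>.\<close>

definition hyperfinite_seq :: "'v \<Rightarrow> 'v \<Rightarrow> bool" where
  "hyperfinite_seq n h \<longleftrightarrow>
     n \<in> hypernats \<and>
     (\<forall>p \<in> members smem h. \<exists>i y. is_opair smem p i y \<and> hle i n) \<and>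
     (\<forall>i. hle i n \<longrightarrow> (\<exists>!y. (i, y) \<in> rel_of smem h))"

definition iota_rel :: "'u set \<Rightarrow> ('u \<times> 'u) set set \<Rightarrow> 'u \<Rightarrow> ('v \<times> 'v) set" where
  "iota_rel X C \<xi> =
     {(x, y). x \<in> inf_points X C \<xi> \<and> y \<in> inf_points X C \<xi> \<and>
        (\<exists>n h. hyperfinite_seq n h \<and>
           app (rel_of smem h) (star (num 0)) = x \<and>
           app (rel_of smem h) n = y \<and>
           (\<forall>i. hle i n \<longrightarrow> app (rel_of smem h) i \<in> inf_points X C \<xi>) \<and>
           (\<forall>i. hless i n \<longrightarrow>
              near C (app (rel_of smem h) i) (app (rel_of smem h) (hsuc i))))}"

definition iota :: "'u set \<Rightarrow> ('u \<times> 'u) set set \<Rightarrow> 'u \<Rightarrow> 'v set set" where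
  "iota X C \<xi> = inf_points X C \<xi> // iota_rel X C \<xi>"

definition omega_map ::
  "'u set \<Rightarrow> ('u \<times> 'u) set set \<Rightarrow> 'u \<Rightarrow> (nat \<Rightarrow> 'u) set \<Rightarrow> 'v set" where
  "omega_map X C \<xi> c =
     (THE q. \<forall>s\<in>c. \<forall>i\<in>infinite_hypernats. q = iota_rel X C \<xi> `` {star_seq s i})"

end

end

theory Submission
  imports Defs
begin

text \<open>
  Let \<open>linked n\<close> be the relation ``joined by a chain of steps of length at most 1 outside the
  \<open>n\<close>-ball around the basepoint''. Saturation shows that \<open>x\<close> and \<open>y\<close> represent the same element of
  \<open>\<iota>\<close> iff they are related by the extension of \<open>linked n\<close> for every standard \<open>n\<close>: the steps of a
  hyperfinite chain have a common standard bound and can be subdivided along geodesics, and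
  conversely an infinite \<open>n\<close> for which \<open>x\<close> and \<open>y\<close> are linked gives a hyperfinite chain of points at
  infinity. On the other side, two coarse sequences are equivalent iff their tails are \<open>linked n\<close> for
  every \<open>n\<close>, because linked tails admit a common coarse supersequence. By transfer these two conditions
  match, so \<open>\<omega>\<close> is well defined and injective. For surjectivity, properness provides for each \<open>n\<close>
  finitely many points to one of which every point far enough away is linked; so a point at infinity
  is linked to standard points \<open>f n\<close>, and joining successive \<open>f n\<close> by chains yields a coarse sequence.
\<close>

section \<open>Concatenating finite walks\<close>

text \<open>The relation \<open>near\<close> and the set of points at infinity are external: they
  involve all standard controlled sets at once, so neither can occur in a formula to which
  \<open>elementary\<close> applies. The relations \<open>linked n\<close> are standard, which
  leaves only the quantifier over standard \<open>n\<close> outside the transferred formulae;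
  saturation is what moves that quantifier across an internal chain. On the classical side the
  obstacle is that a subsequence with unbounded gaps need not be bornologous, so two sequences
  running to the same end cannot simply be thinned out to a common subsequence. Equivalences are
  therefore realised from above, by interleaving, and new coarse sequences are built as infinite
  concatenations of finite lists, with block \<open>k\<close> outside the \<open>k\<close>-ball for
  positive \<open>k\<close>.\<close>

lemma block_index:
  fixes l :: "nat \<Rightarrow> nat"
  assumes "\<And>k. 0 < l k"
  obtains k j where "m = (\<Sum>i<k. l i) + j" and "j < l k"
proof -
  have *: "\<exists>k j. m = (\<Sum>i<k. l i) + j \<and> j < l k"
  proof (induction m)
    case 0
    show ?case
      using assms[of 0] by (intro exI[of _ 0]) simp
  next
    case (Suc m)
    then obtain k j where kj: "m = (\<Sum>i<k. l i) + j" "j < l k"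
      by blast
    show ?case
    proof (cases "Suc j < l k")
      case True
      then show ?thesis
        using kj by (intro exI[of _ k] exI[of _ "Suc j"]) simp
    next
      case False
      then have "Suc j = l k"
        using kj by simp
      then show ?thesis
        using kj assms[of "Suc k"] by (intro exI[of _ "Suc k"] exI[of _ 0]) simp
    qed
  qed
  then show ?thesis
    using that by blast
qed

lemma block_offset_mono:
  fixes l :: "nat \<Rightarrow> nat"
  shows "k \<le> k' \<Longrightarrow> (\<Sum>i<k. l i) \<le> (\<Sum>i<k'. l i)"
  by (rule sum_mono2) auto

text \<open>A later block starts no earlier than an earlier one ends, so no position lies in two
  blocks.\<close>

lemma block_index_unique:
  fixes l :: "nat \<Rightarrow> nat"
  assumes "(\<Sum>i<k. l i) + j = (\<Sum>i<k'. l i) + j'" "j < l k" "j' < l k'"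
  shows "k = k' \<and> j = j'"
proof -
  have False if "(\<Sum>i<a. l i) + b = (\<Sum>i<a'. l i) + b'" "b < l a" "a < a'" for a b a' b'
    using block_offset_mono[of "Suc a" a' l] that by simp
  from this[of k j k' j'] this[of k' j' k j] have "k = k'"
    using assms by (metis linorder_neqE_nat)
  then show ?thesis
    using assms(1) by simp
qed

text \<open>The infinite concatenation of \<open>L 0\<close>, \<open>L 1\<close>, and so on. The
  chosen pair of block and offset is unique whenever it exists, and it exists for every
  \<open>m\<close> if no list is empty.\<close>

definition concat_seq :: "(nat \<Rightarrow> 'a list) \<Rightarrow> nat \<Rightarrow> 'a" where
  "concat_seq L m =
     (let p = (SOME p. m = (\<Sum>i<fst p. length (L i)) + snd p \<and> snd p < length (L (fst p)))
      in L (fst p) ! snd p)"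

lemma concat_seq_block:
  assumes "j < length (L k)"
  shows "concat_seq L ((\<Sum>i<k. length (L i)) + j) = L k ! j"
proof -
  let ?P = "\<lambda>p. (\<Sum>i<k. length (L i)) + j = (\<Sum>i<fst p. length (L i)) + snd p \<and>
                snd p < length (L (fst p))"
  have "?P (k, j)"
    using assms by simp
  then have "?P (Eps ?P)"
    by (rule someI)
  then have "k = fst (Eps ?P) \<and> j = snd (Eps ?P)"
    using assms block_index_unique by blast
  then have "Eps ?P = (k, j)"
    by (simp add: prod_eq_iff)
  then show ?thesis
    by (simp add: concat_seq_def)
qed

lemma concat_seq_0:
  assumes "L 0 \<noteq> []"
  shows "concat_seq L 0 = hd (L 0)"
  using concat_seq_block[of 0 L 0] assms by (simp add: hd_conv_nth)

text \<open>Turns a condition on almost all blocks into one on almost all terms; properness of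
  concatenated sequences rests on this.\<close>

lemma concat_seq_in_tail:
  assumes "\<And>k. L k \<noteq> []" and "(\<Sum>i<k. length (L i)) \<le> m"
  shows "\<exists>k'\<ge>k. concat_seq L m \<in> set (L k')"
proof -
  obtain k' j where m: "m = (\<Sum>i<k'. length (L i)) + j" and j: "j < length (L k')"
    using block_index[of "\<lambda>k. length (L k)"] assms(1) by blast
  have "k \<le> k'"
  proof (rule ccontr)
    assume "\<not> k \<le> k'"
    then show False
      using block_offset_mono[of "Suc k'" k "\<lambda>k. length (L k)"] m j assms(2) by simp
  qed
  then show ?thesis
    using concat_seq_block[of j L k', OF j] j m by auto
qed

lemma concat_seq_step:
  assumes "\<And>k. L k \<noteq> []" and "\<And>k. successively R (L k)"
    and "\<And>k. R (last (L k)) (hd (L (Suc k)))"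
  shows "R (concat_seq L m) (concat_seq L (Suc m))"
proof -
  obtain k j where m: "m = (\<Sum>i<k. length (L i)) + j" and j: "j < length (L k)"
    using block_index[of "\<lambda>k. length (L k)"] assms(1) by blast
  show ?thesis
  proof (cases "Suc j < length (L k)")
    case True
    then show ?thesis
      using concat_seq_block[of j L k, OF j] concat_seq_block[of "Suc j" L k, OF True] successively_nth[OF assms(2) True] m
      by simp
  next
    case False
    then have jk: "Suc j = length (L k)"
      using j by simp
    then have "Suc m = (\<Sum>i<Suc k. length (L i)) + 0"
      using m by simp
    then have "concat_seq L (Suc m) = hd (L (Suc k))"
      using concat_seq_block[of 0 L "Suc k"] assms(1) by (metis hd_conv_nth length_greater_0_conv)
    moreover have "concat_seq L m = last (L k)"
      using concat_seq_block[of j L k, OF j] m jk assms(1)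
      by (metis add.commute add_diff_cancel_left' last_conv_nth plus_1_eq_Suc)
    ultimately show ?thesis
      using assms(3) by simp
  qed
qed

text \<open>The intervals from \<open>i k\<close> to \<open>i (Suc k)\<close> partition the
  naturals, so the middle parts of the blocks, read in order, spell out \<open>s\<close>. The lists
  \<open>A k\<close> and \<open>B k\<close> absorb the rest of each block, so the same lemma serves
  for both of two interleaved sequences.\<close>

lemma is_subseq_concat_seq:
  assumes i: "strict_mono i" "i 0 = 0"
    and L: "\<And>k. L k = A k @ map s [i k..<i (Suc k)] @ B k"
  shows "is_subseq s (concat_seq L)"
proof -
  define l where "l k = i (Suc k) - i k" for k :: nat
  define off where "off k = (\<Sum>i<k. length (L i))" for k
  have less: "i k < i (Suc k)" for k
    using i(1) by (simp add: strict_mono_less)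
  then have l_pos: "0 < l k" for k
    by (simp add: l_def)
  \<comment> \<open>The sum telescopes; \<open>i 0 = 0\<close> removes the lower end.\<close>
  have offs: "(\<Sum>i<k. l i) = i k" for k
  proof (induction k)
    case (Suc k)
    then show ?case
      using less[of k] by (simp add: l_def)
  qed (simp add: i)
  have "\<exists>k j. m = i k + j \<and> j < l k" for m
    using block_index[of l m, OF l_pos] offs by metis
  then obtain K J where m: "\<And>m. m = i (K m) + J m" and J: "\<And>m. J m < l (K m)"
    by metis
  \<comment> \<open>The position at which \<open>s m\<close> occurs: start of its block, prefix
    \<open>A\<close>, offset inside the segment.\<close>
  define r where "r m = off (K m) + (length (A (K m)) + J m)" for m
  have len: "length (A k) + j < length (L k)" if "j < l k" for k j
    using that by (simp add: L l_def)
  have "concat_seq L (r m) = s m" for m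
  proof -
    have "concat_seq L (r m) = L (K m) ! (length (A (K m)) + J m)"
      unfolding r_def off_def by (rule concat_seq_block) (rule len[OF J])
    also have "\<dots> = s (i (K m) + J m)"
      using J[of m] by (simp add: L nth_append l_def)
    finally show ?thesis
      using m by simp
  qed
  moreover have "r m < r (Suc m)" for m
  proof (cases "Suc (J m) < l (K m)")
    case True
    have "K (Suc m) = K m \<and> J (Suc m) = Suc (J m)"
    proof (rule block_index_unique[of l])
      show "(\<Sum>i<K (Suc m). l i) + J (Suc m) = (\<Sum>i<K m. l i) + Suc (J m)"
        using m by (metis add_Suc_right offs)
    qed (use J True in auto)
    then show ?thesis
      by (simp add: r_def)
  next
    case False
    then have *: "Suc (J m) = l (K m)"
      using J[of m] by simp
    have "K (Suc m) = Suc (K m) \<and> J (Suc m) = 0"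
    proof (rule block_index_unique[of l])
      show "(\<Sum>i<K (Suc m). l i) + J (Suc m) = (\<Sum>i<Suc (K m). l i) + 0"
        using m * by (metis add_Suc_right add_0_right offs sum.lessThan_Suc)
    qed (use J l_pos in auto)
    moreover have "off (Suc k) = off k + length (L k)" for k
      by (simp add: off_def)
    ultimately show ?thesis
      using len[OF J, of m] by (simp add: r_def)
  qed
  ultimately show ?thesis
    unfolding is_subseq_def by (metis (no_types) comp_apply ext strict_mono_Suc_iff)
qed

section \<open>Pointed proper geodesic metric spaces\<close>

locale pointed_proper_geodesic_space = Metric_space X d
  for X :: "'a set" and d :: "'a \<Rightarrow> 'a \<Rightarrow> real" +
  fixes \<xi> :: 'a
  assumes basepoint: "\<xi> \<in> X"
    and proper: "proper_metric X d"
    and geodesic: "geodesic_metric X d"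
begin

definition far :: "nat \<Rightarrow> 'a set" where
  "far n = {x \<in> X. real n < d \<xi> x}"

text \<open>These sets are cofinal among the controlled sets. Integer bounds make the family
  countable and increasing, the form in which saturation over the numerals is applied.\<close>

definition near_rel :: "nat \<Rightarrow> ('a \<times> 'a) set" where
  "near_rel k = {(x, y). x \<in> X \<and> y \<in> X \<and> d x y \<le> real k}"

text \<open>The closure is transitive but not reflexive, so linked points are always in
  \<open>far n\<close>; reflexivity on \<open>far n\<close> comes from steps of length 0.\<close>

definition linked :: "nat \<Rightarrow> ('a \<times> 'a) set" where
  "linked n = (near_rel 1 \<inter> far n \<times> far n)\<^sup>+"

lemma far_subset: "far n \<subseteq> X"
  by (auto simp: far_def)

lemma far_antimono: "m \<le> n \<Longrightarrow> far n \<subseteq> far m"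
  by (auto simp: far_def)

lemma linked_far: "linked n \<subseteq> far n \<times> far n"
  unfolding linked_def by (rule trancl_subset_Sigma) blast

lemma linkedI: "x \<in> far n \<Longrightarrow> y \<in> far n \<Longrightarrow> d x y \<le> 1 \<Longrightarrow> (x, y) \<in> linked n"
  unfolding linked_def by (rule r_into_trancl) (auto simp: near_rel_def far_def)

lemma linked_refl: "x \<in> far n \<Longrightarrow> (x, x) \<in> linked n"
  by (rule linkedI) (auto simp: far_def)

lemma linked_sym: "(x, y) \<in> linked n \<Longrightarrow> (y, x) \<in> linked n"
proof -
  have "sym (near_rel 1 \<inter> far n \<times> far n)"
    by (auto simp: sym_def near_rel_def commute)
  then show "(x, y) \<in> linked n \<Longrightarrow> (y, x) \<in> linked n"
    unfolding linked_def by (meson sym_trancl symD)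
qed

lemma linked_trans: "(x, y) \<in> linked n \<Longrightarrow> (y, z) \<in> linked n \<Longrightarrow> (x, z) \<in> linked n"
  unfolding linked_def by (rule trancl_trans)

lemma linked_antimono: "m \<le> n \<Longrightarrow> linked n \<subseteq> linked m"
  unfolding linked_def using far_antimono[of m n] by (intro trancl_mono_subset) blast

lemma linked_funE:
  assumes "(x, y) \<in> linked n"
  obtains f N where "f 0 = x" "f N = y" "\<And>i. i \<le> N \<Longrightarrow> f i \<in> far n"
    "\<And>i. i < N \<Longrightarrow> d (f i) (f (Suc i)) \<le> 1"
proof -
  obtain N where "(x, y) \<in> (near_rel 1 \<inter> far n \<times> far n) ^^ N"
    using assms unfolding linked_def by (meson trancl_power)
  then obtain f where f: "f 0 = x" "f N = y"
      "\<And>i. i < N \<Longrightarrow> (f i, f (Suc i)) \<in> near_rel 1 \<inter> far n \<times> far n"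
    unfolding relpow_fun_conv by blast
  have "f i \<in> far n" if "i \<le> N" for i
  proof (cases "i < N")
    case True
    then show ?thesis
      using f(3)[of i] by blast
  next
    case False
    then show ?thesis
      using that f(2) linked_far assms by auto
  qed
  then show ?thesis
    using that[of f N] f by (auto simp: near_rel_def)
qed

lemma linked_funI:
  assumes "\<And>i. i \<le> N \<Longrightarrow> f i \<in> far n" and "\<And>i. i < N \<Longrightarrow> (f i, f (Suc i)) \<in> linked n"
  shows "(f 0, f N) \<in> linked n"
  using assms
proof (induction N)
  case 0
  then show ?case
    by (simp add: linked_refl)
next
  case (Suc N)
  then show ?case
    using linked_trans[of "f 0" "f N" n "f (Suc N)"] by simp
qed

text \<open>The list form of a chain, suited to concatenation; the indexed form in
  \<open>linked_funE\<close> is the one that gets coded as an internal function.\<close>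

definition chain_list :: "nat \<Rightarrow> 'a \<Rightarrow> 'a \<Rightarrow> 'a list \<Rightarrow> bool" where
  "chain_list n x y c \<longleftrightarrow> c \<noteq> [] \<and> hd c = x \<and> last c = y \<and> set c \<subseteq> far n \<and>
     successively (\<lambda>a b. d a b \<le> 1) c"

lemma linked_listE:
  assumes "(x, y) \<in> linked n"
  obtains c where "chain_list n x y c"
proof -
  obtain f N where f: "f 0 = x" "f N = y" "\<And>i. i \<le> N \<Longrightarrow> f i \<in> far n"
    "\<And>i. i < N \<Longrightarrow> d (f i) (f (Suc i)) \<le> 1"
    using linked_funE[OF assms] by blast
  have "chain_list n x y (map f [0..<Suc N])"
    unfolding chain_list_def successively_map
  proof (intro conjI)
    show "successively (\<lambda>i j. d (f i) (f j) \<le> 1) [0..<Suc N]"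
      unfolding successively_conv_nth using f(4) by (simp del: upt_Suc)
    show "set (map f [0..<Suc N]) \<subseteq> far n"
      using f(3) by auto
  qed (use f(1,2) in \<open>simp_all add: hd_map last_map del: upt_Suc\<close>)
  then show ?thesis
    using that by blast
qed

lemma linked_listI:
  assumes "successively (\<lambda>a b. d a b \<le> 1) c" and "set c \<subseteq> far n" and "x \<in> set c" "y \<in> set c"
  shows "(x, y) \<in> linked n"
proof -
  have "(hd c, z) \<in> linked n" if z: "z \<in> set c" for z
  proof -
    obtain N where N: "N < length c" "z = c ! N"
      using z unfolding in_set_conv_nth by blast
    have "(c ! 0, c ! N) \<in> linked n"
    proof (rule linked_funI)
      show "c ! i \<in> far n" if "i \<le> N" for i
        using nth_mem[of i c] that N(1) assms(2) by auto
      show "(c ! i, c ! Suc i) \<in> linked n" if "i < N" for i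
        using that N(1) assms(2) nth_mem[of i c] nth_mem[of "Suc i" c]
        by (intro linkedI successively_nth[OF assms(1)]) auto
    qed
    then show ?thesis
      using N z by (metis empty_iff hd_conv_nth set_empty)
  qed
  from linked_trans[OF linked_sym[OF this[OF assms(3)]] this[OF assms(4)]] show ?thesis .
qed

text \<open>Cutting the interval into \<open>N > T\<close> equal pieces gives steps of length at
  most 1; the strict inequality keeps \<open>N\<close> positive when \<open>T = 0\<close>.\<close>

lemma linked_isometric_segment:
  assumes "0 \<le> T" and g: "\<And>t. t \<in> {0..T} \<Longrightarrow> g t \<in> far n"
    and iso: "\<And>s t. s \<in> {0..T} \<Longrightarrow> t \<in> {0..T} \<Longrightarrow> d (g s) (g t) = \<bar>s - t\<bar>"
  shows "(g 0, g T) \<in> linked n"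
proof -
  obtain N where N: "T < real N"
    using reals_Archimedean2 by blast
  define u where "u i = T * (real i / real N)" for i :: nat
  have "0 < N"
    using N \<open>0 \<le> T\<close> by (cases N) auto
  have u: "u i \<in> {0..T}" if "i \<le> N" for i
    using that \<open>0 \<le> T\<close> \<open>0 < N\<close> by (auto simp: u_def divide_le_eq mult_left_mono)
  have "\<bar>u i - u (Suc i)\<bar> \<le> 1" for i
  proof -
    have "u i - u (Suc i) = - (T / real N)"
      using \<open>0 < N\<close> by (simp add: u_def field_simps)
    moreover have "0 \<le> T / real N" "T / real N \<le> 1"
      using N \<open>0 \<le> T\<close> by (simp_all add: divide_le_eq_1)
    ultimately show ?thesis
      by simp
  qed
  then have "((\<lambda>i. g (u i)) 0, (\<lambda>i. g (u i)) N) \<in> linked n"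
    using u iso g by (intro linked_funI linkedI) auto
  then show ?thesis
    using \<open>0 < N\<close> by (simp add: u_def)
qed

lemma geodesicE:
  assumes "x \<in> X" "y \<in> X"
  obtains g where "g 0 = x" "g (d x y) = y" "\<And>t. t \<in> {0..d x y} \<Longrightarrow> g t \<in> X"
    "\<And>s t. s \<in> {0..d x y} \<Longrightarrow> t \<in> {0..d x y} \<Longrightarrow> d (g s) (g t) = \<bar>s - t\<bar>"
  using geodesic assms unfolding geodesic_metric_def Pi_def by blast

text \<open>A geodesic of length at most \<open>k\<close> stays within \<open>k\<close> of its
  starting point, so it comes at most \<open>k\<close> closer to the basepoint. Every later shift
  between \<open>n + k\<close> and \<open>n\<close> has this origin.\<close>

lemma near_far_linked:
  assumes "x \<in> far (n + k)" "y \<in> far (n + k)" "d x y \<le> real k"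
  shows "(x, y) \<in> linked n"
proof -
  have xy: "x \<in> X" "y \<in> X"
    using assms far_subset by auto
  then obtain g where g: "g 0 = x" "g (d x y) = y" "\<And>t. t \<in> {0..d x y} \<Longrightarrow> g t \<in> X"
    "\<And>s t. s \<in> {0..d x y} \<Longrightarrow> t \<in> {0..d x y} \<Longrightarrow> d (g s) (g t) = \<bar>s - t\<bar>"
    using geodesicE by blast
  have "g t \<in> far n" if t: "t \<in> {0..d x y}" for t
  proof -
    have "d (g t) x = t"
      using g(4)[OF t, of 0] t g(1) nonneg[of x y] by auto
    moreover have "d \<xi> x \<le> d \<xi> (g t) + d (g t) x"
      using triangle basepoint g(3)[OF t] xy by blast
    ultimately show ?thesis
      using assms(1,3) t g(3)[OF t] by (auto simp: far_def)
  qed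
  then have "(g 0, g (d x y)) \<in> linked n"
    using g(4) nonneg by (intro linked_isometric_segment) auto
  then show ?thesis
    using g by simp
qed

text \<open>Every component of the complement of a ball that leaves a slightly larger ball crosses a
  bounded annulus, which by properness is totally bounded.\<close>

lemma finite_representatives:
  "\<exists>F. finite F \<and> F \<subseteq> far n \<and> (\<forall>y\<in>far (Suc n). \<exists>f\<in>F. (f, y) \<in> linked n)"
proof -
  define A where "A = far (Suc n) \<inter> mcball \<xi> (real n + 2)"
  \<comment> \<open>Properness gives compactness of the closed ball. Total boundedness, unlike
    compactness, passes to the subset \<open>A\<close>, which need not be closed.\<close>
  have "compactin mtopology (mcball \<xi> (real n + 2))"
    using proper unfolding proper_metric_def by (simp add: closedin_mcball mbounded_mcball)
  then have "mtotally_bounded A"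
    unfolding A_def
    by (meson compactin_imp_mtotally_bounded inf.cobounded2 mtotally_bounded_subset)
  then obtain F where F: "finite F" "F \<subseteq> A" "A \<subseteq> (\<Union>x\<in>F. mball x 1)"
    unfolding mtotally_bounded_def by (meson zero_less_one)
  have near: "\<exists>f\<in>F. (f, y) \<in> linked n" if "y \<in> A" for y
  proof -
    obtain f where f: "f \<in> F" "d f y < 1"
      using F(3) \<open>y \<in> A\<close> by auto
    then have "(f, y) \<in> linked n"
      using F(2) that far_antimono[of n "Suc n"] by (intro linkedI) (auto simp: A_def)
    then show ?thesis
      using f by blast
  qed
  have "\<exists>f\<in>F. (f, y) \<in> linked n" if y: "y \<in> far (Suc n)" for y
  proof (cases "d \<xi> y \<le> real n + 2")
    case True
    then show ?thesis
      using y near basepoint by (auto simp: A_def far_def)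
  next
    case False
    have yX: "y \<in> X"
      using y far_subset by auto
    obtain g where g: "g 0 = y" "g (d y \<xi>) = \<xi>" "\<And>t. t \<in> {0..d y \<xi>} \<Longrightarrow> g t \<in> X"
      "\<And>s t. s \<in> {0..d y \<xi>} \<Longrightarrow> t \<in> {0..d y \<xi>} \<Longrightarrow> d (g s) (g t) = \<bar>s - t\<bar>"
      using geodesicE[OF yX basepoint] by blast
    \<comment> \<open>The geodesic from \<open>y\<close> towards the basepoint is stopped at
      distance exactly \<open>n + 2\<close>, on the outer rim of the annulus
      \<open>A\<close>.\<close>
    define T where "T = d y \<xi> - (real n + 2)"
    have T: "0 \<le> T" "T \<le> d y \<xi>"
      using False by (auto simp: T_def commute)
    have dist: "d \<xi> (g t) = d y \<xi> - t" if t: "t \<in> {0..d y \<xi>}" for t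
      using g(4)[of "d y \<xi>" t] t g(2) by auto
    have seg: "g t \<in> far (Suc n)" if t: "t \<in> {0..T}" for t
      using dist[of t] t T g(3)[of t] by (auto simp: far_def T_def)
    have "(g 0, g T) \<in> linked (Suc n)"
      using seg g(4) T by (intro linked_isometric_segment) auto
    then have "(g T, y) \<in> linked n"
      using linked_antimono[of n "Suc n"] linked_sym g(1) by auto
    moreover have "g T \<in> A"
      using seg[of T] dist[of T] T g(3)[of T] basepoint by (auto simp: A_def T_def)
    ultimately show ?thesis
      using near linked_trans by blast
  qed
  moreover have "F \<subseteq> far n"
    using F(2) far_antimono[of n "Suc n"] by (auto simp: A_def)
  ultimately show ?thesis
    using F(1) by blast
qed

section \<open>Coarse sequences and ends\<close>

lemma bounded_coarse_near_rel:
  "E \<in> bounded_coarse X d \<longleftrightarrow> (\<exists>k. E \<subseteq> near_rel k)"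
proof
  assume E: "E \<in> bounded_coarse X d"
  then obtain M where M: "\<And>p. p \<in> E \<Longrightarrow> (case p of (x, y) \<Rightarrow> d x y) \<le> M"
    unfolding bounded_coarse_def bdd_above_def by blast
  obtain k where "M \<le> real k"
    using real_arch_simple by blast
  then have "E \<subseteq> near_rel k"
    using E M unfolding bounded_coarse_def near_rel_def by fastforce
  then show "\<exists>k. E \<subseteq> near_rel k" ..
next
  assume "\<exists>k. E \<subseteq> near_rel k"
  then obtain k where k: "E \<subseteq> near_rel k" ..
  then have "bdd_above ((\<lambda>(x, y). d x y) ` E)"
    unfolding bdd_above_def near_rel_def by (intro exI[of _ "real k"]) auto
  then show "E \<in> bounded_coarse X d"
    using k unfolding bounded_coarse_def near_rel_def by auto
qed

lemma nat_coarse_iff: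
  "E \<in> nat_coarse \<longleftrightarrow> (\<exists>k. \<forall>(i, j)\<in>E. i \<le> j + k \<and> j \<le> i + k)"
proof
  assume "E \<in> nat_coarse"
  then obtain M where M: "\<And>p. p \<in> E \<Longrightarrow> (case p of (i, j) \<Rightarrow> \<bar>real i - real j\<bar>) \<le> M"
    unfolding nat_coarse_def bounded_coarse_def bdd_above_def by blast
  obtain k where k: "M \<le> real k"
    using real_arch_simple by blast
  have "i \<le> j + k \<and> j \<le> i + k" if "(i, j) \<in> E" for i j
  proof -
    have "\<bar>real i - real j\<bar> \<le> real k"
      using M[OF that] k by simp
    then show ?thesis
      by linarith
  qed
  then show "\<exists>k. \<forall>(i, j)\<in>E. i \<le> j + k \<and> j \<le> i + k"
    by blast
next
  assume "\<exists>k. \<forall>(i, j)\<in>E. i \<le> j + k \<and> j \<le> i + k"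
  then obtain k where k: "\<And>i j. (i, j) \<in> E \<Longrightarrow> i \<le> j + k \<and> j \<le> i + k"
    by blast
  have "\<bar>real i - real j\<bar> \<le> real k" if "(i, j) \<in> E" for i j
    using k[OF that] by linarith
  then show "E \<in> nat_coarse"
    unfolding nat_coarse_def bounded_coarse_def bdd_above_def
    by (intro CollectI conjI exI[of _ "real k"]) auto
qed

text \<open>On the naturals a bound on consecutive terms already implies a Lipschitz bound, hence
  bornologicity; and since bounded sets are those contained in a ball, properness is divergence from
  the basepoint.\<close>

lemma coarse_seqs_iff:
  "s \<in> coarse_seqs X (bounded_coarse X d) \<xi> \<longleftrightarrow>
     range s \<subseteq> X \<and> s 0 = \<xi> \<and> (\<exists>k. \<forall>m. d (s m) (s (Suc m)) \<le> real k) \<and>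
     (\<forall>n. \<exists>m. \<forall>a\<ge>m. s a \<in> far n)" (is "?L \<longleftrightarrow> ?R")
proof
  assume L: ?L
  then have sX: "range s \<subseteq> X" and s0: "s 0 = \<xi>"
    and proper_s: "\<And>B. coarse_bounded X (bounded_coarse X d) B \<Longrightarrow>
        coarse_bounded UNIV nat_coarse (s -` B)"
    and born: "\<And>E. E \<in> nat_coarse \<Longrightarrow> map_prod s s ` E \<in> bounded_coarse X d"
    unfolding coarse_seqs_def coarse_map_def by auto
  have "\<exists>k. \<forall>m. d (s m) (s (Suc m)) \<le> real k"
  proof -
    \<comment> \<open>Bornologicity is applied to the graph of the successor.\<close>
    have "range (\<lambda>m. (m, Suc m)) \<in> nat_coarse"
      unfolding nat_coarse_iff by (intro exI[of _ 1]) auto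
    then obtain k where k: "map_prod s s ` range (\<lambda>m. (m, Suc m)) \<subseteq> near_rel k"
      using born bounded_coarse_near_rel by blast
    have "(s m, s (Suc m)) \<in> near_rel k" for m
      using k by (force simp: image_image)
    then show ?thesis
      by (auto simp: near_rel_def)
  qed
  moreover have "\<exists>m. \<forall>a\<ge>m. s a \<in> far n" for n
  proof -
    define B where "B = X - far n"
    have dB: "d \<xi> x \<le> real n" if "x \<in> B" for x
      using that by (auto simp: B_def far_def)
    have "B \<times> B \<subseteq> near_rel (n + n)"
    proof clarify
      fix x y assume xy: "x \<in> B" "y \<in> B"
      then have "d x y \<le> d \<xi> x + d \<xi> y"
        using triangle[of x \<xi> y] basepoint commute[of x \<xi>] by (auto simp: B_def)
      then show "(x, y) \<in> near_rel (n + n)"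
        using dB[of x] dB[of y] xy by (auto simp: near_rel_def B_def)
    qed
    then have "coarse_bounded X (bounded_coarse X d) B"
      unfolding coarse_bounded_def bounded_coarse_near_rel by (auto simp: B_def)
    then have "s -` B \<times> s -` B \<in> nat_coarse"
      using proper_s by (auto simp: coarse_bounded_def)
    then obtain k where k: "\<And>i j. i \<in> s -` B \<Longrightarrow> j \<in> s -` B \<Longrightarrow> i \<le> j + k"
      unfolding nat_coarse_iff by auto
    \<comment> \<open>The preimage contains 0, so its diameter bound \<open>k\<close> bounds all of
      its elements.\<close>
    have "0 \<in> s -` B"
      using s0 basepoint by (auto simp: B_def far_def)
    then have "s a \<in> far n" if "a \<ge> Suc k" for a
      using k[of a 0] that sX by (force simp: B_def)
    then show ?thesis
      by blast
  qed
  ultimately show ?R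
    using sX s0 by blast
next
  assume R: ?R
  then have sX: "\<And>m. s m \<in> X" and s0: "s 0 = \<xi>"
    by auto
  obtain K where K: "\<And>m. d (s m) (s (Suc m)) \<le> real K"
    using R by blast
  have lip: "d (s m) (s (m + j)) \<le> real (K * j)" for m j
  proof (induction j)
    case 0
    then show ?case
      using sX by simp
  next
    case (Suc j)
    have "d (s m) (s (m + Suc j)) \<le> d (s m) (s (m + j)) + d (s (m + j)) (s (Suc (m + j)))"
      using triangle sX by simp
    then show ?case
      using Suc K[of "m + j"] by (simp add: algebra_simps)
  qed
  have lip': "d (s i) (s j) \<le> real (K * k)" if "i \<le> j + k" "j \<le> i + k" for i j k
  proof -
    have *: "d (s i) (s j) \<le> real (K * k)" if "i \<le> j" "j \<le> i + k" for i j
    proof -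
      have "d (s i) (s j) \<le> real (K * (j - i))"
        using lip[of i "j - i"] that by simp
      also have "\<dots> \<le> real (K * k)"
        using that by (intro of_nat_mono mult_le_mono2) simp
      finally show ?thesis .
    qed
    show ?thesis
      using *[of i j] *[of j i] that commute[of "s i" "s j"] by (cases "i \<le> j") auto
  qed
  have "coarse_bounded UNIV nat_coarse (s -` B)" if B: "coarse_bounded X (bounded_coarse X d) B" for B
  proof (cases "B = {}")
    case True
    then show ?thesis
      by (auto simp: coarse_bounded_def nat_coarse_iff)
  next
    case False
    then obtain b where b: "b \<in> B"
      by blast
    obtain k where k: "B \<times> B \<subseteq> near_rel k" and BX: "B \<subseteq> X"
      using B unfolding coarse_bounded_def bounded_coarse_near_rel by blast
    \<comment> \<open>The set \<open>B\<close> has diameter at most \<open>k\<close>, so it lies in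
      the \<open>n\<close>-ball around the basepoint.\<close>
    obtain n where n: "d \<xi> b + real k \<le> real n"
      using real_arch_simple by blast
    obtain m where m: "\<And>a. a \<ge> m \<Longrightarrow> s a \<in> far n"
      using R by blast
    have "a < m" if "a \<in> s -` B" for a
    proof (rule ccontr)
      assume "\<not> a < m"
      then have "real n < d \<xi> (s a)"
        using m by (auto simp: far_def)
      moreover have "d \<xi> (s a) \<le> d \<xi> b + d b (s a)"
        using triangle basepoint b BX sX by blast
      moreover have "d b (s a) \<le> real k"
        using k b that by (auto simp: near_rel_def)
      ultimately show False
        using n by simp
    qed
    then show ?thesis
      unfolding coarse_bounded_def nat_coarse_iff by (fastforce intro: exI[of _ m])
  qed
  moreover have "map_prod s s ` E \<in> bounded_coarse X d" if "E \<in> nat_coarse" for E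
  proof -
    obtain k where k: "\<And>i j. (i, j) \<in> E \<Longrightarrow> i \<le> j + k \<and> j \<le> i + k"
      using \<open>E \<in> nat_coarse\<close> unfolding nat_coarse_iff by blast
    have "map_prod s s ` E \<subseteq> near_rel (K * k)"
      using lip' k sX by (fastforce simp: near_rel_def)
    then show ?thesis
      unfolding bounded_coarse_near_rel by blast
  qed
  ultimately show ?L
    using s0 sX unfolding coarse_seqs_def coarse_map_def by auto
qed

text \<open>Convergence to the same end of the space: for each \<open>n\<close> both tails lie in
  one class of \<open>linked n\<close>.\<close>

definition coend :: "(nat \<Rightarrow> 'a) \<Rightarrow> (nat \<Rightarrow> 'a) \<Rightarrow> bool" where
  "coend s t \<longleftrightarrow> (\<forall>n. \<exists>m. \<forall>a\<ge>m. \<forall>b\<ge>m. (s a, t b) \<in> linked n)"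

text \<open>If \<open>k\<close> bounds the steps, each step of the tail outside the
  \<open>(n + k)\<close>-ball can be subdivided outside the \<open>n\<close>-ball.\<close>

lemma coend_refl:
  assumes "s \<in> coarse_seqs X (bounded_coarse X d) \<xi>"
  shows "coend s s"
  unfolding coend_def
proof
  fix n
  obtain k where k: "\<And>m. d (s m) (s (Suc m)) \<le> real k"
    using assms coarse_seqs_iff by blast
  obtain m where m: "\<And>a. a \<ge> m \<Longrightarrow> s a \<in> far (n + k)"
    using assms coarse_seqs_iff by blast
  have "(s (m + 0), s (m + j)) \<in> linked n" for j
    using m k far_antimono[of n "n + k"]
    by (intro linked_funI[of j "\<lambda>j. s (m + j)"] near_far_linked[of _ n k]) auto
  then have "(s m, s a) \<in> linked n" if "a \<ge> m" for a
    using that by (metis add_0_right le_add_diff_inverse)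
  then show "\<exists>m. \<forall>a\<ge>m. \<forall>b\<ge>m. (s a, s b) \<in> linked n"
    using linked_sym linked_trans by blast
qed

lemma coend_sym: "coend s t \<Longrightarrow> coend t s"
  unfolding coend_def using linked_sym by blast

lemma coend_trans:
  assumes "coend s t" "coend t u"
  shows "coend s u"
  unfolding coend_def
proof
  fix n
  obtain m where m: "\<And>a b. a \<ge> m \<Longrightarrow> b \<ge> m \<Longrightarrow> (s a, t b) \<in> linked n"
    using assms(1) unfolding coend_def by blast
  obtain m' where m': "\<And>a b. a \<ge> m' \<Longrightarrow> b \<ge> m' \<Longrightarrow> (t a, u b) \<in> linked n"
    using assms(2) unfolding coend_def by blast
  have "(s a, u b) \<in> linked n" if "a \<ge> max m m'" "b \<ge> max m m'" for a b
    using linked_trans[OF m[of a "max m m'"] m'[of "max m m'" b]] that by simp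
  then have "\<forall>a\<ge>max m m'. \<forall>b\<ge>max m m'. (s a, u b) \<in> linked n"
    by blast
  then show "\<exists>m. \<forall>a\<ge>m. \<forall>b\<ge>m. (s a, u b) \<in> linked n" ..
qed

lemma coend_subseq:
  assumes "is_subseq s t" and "t \<in> coarse_seqs X (bounded_coarse X d) \<xi>"
  shows "coend s t"
proof -
  obtain r where r: "strict_mono r" "s = t \<circ> r"
    using assms(1) unfolding is_subseq_def by blast
  then have "m \<le> r a" if "m \<le> a" for m a
    using strict_mono_imp_increasing[of r a] that by linarith
  then show ?thesis
    using coend_refl[OF assms(2)] r(2) unfolding coend_def by (metis comp_apply)
qed

text \<open>By \<open>coend_refl\<close> each tail lies in a single class, so one link between late
  terms joins the tails. A relation between values at infinite indices yields only such single
  links.\<close>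

lemma coend_frequently:
  assumes s: "s \<in> coarse_seqs X (bounded_coarse X d) \<xi>"
    and t: "t \<in> coarse_seqs X (bounded_coarse X d) \<xi>"
    and st: "\<And>n m. \<exists>a\<ge>m. \<exists>b\<ge>m. (s a, t b) \<in> linked n"
  shows "coend s t"
  unfolding coend_def
proof
  fix n
  obtain m where m: "\<And>a b. a \<ge> m \<Longrightarrow> b \<ge> m \<Longrightarrow> (s a, s b) \<in> linked n"
    using coend_refl[OF s] unfolding coend_def by blast
  obtain m' where m': "\<And>a b. a \<ge> m' \<Longrightarrow> b \<ge> m' \<Longrightarrow> (t a, t b) \<in> linked n"
    using coend_refl[OF t] unfolding coend_def by blast
  obtain a b where ab: "a \<ge> max m m'" "b \<ge> max m m'" "(s a, t b) \<in> linked n"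
    using st by blast
  have "(s a', t b') \<in> linked n" if "a' \<ge> max m m'" "b' \<ge> max m m'" for a' b'
    using linked_trans[OF m[of a' a] linked_trans[OF ab(3) m'[of b b']]] ab that by simp
  then have "\<forall>a\<ge>max m m'. \<forall>b\<ge>max m m'. (s a, t b) \<in> linked n"
    by blast
  then show "\<exists>m. \<forall>a\<ge>m. \<forall>b\<ge>m. (s a, t b) \<in> linked n" ..
qed

text \<open>The condition \<open>far\<close> has to spare block 0, which begins at the basepoint, a
  point that is not even in \<open>far 0\<close>.\<close>

lemma concat_seq_coarse:
  assumes ne: "\<And>k. L k \<noteq> []" and X: "\<And>k. set (L k) \<subseteq> X" and hd: "hd (L 0) = \<xi>"
    and step: "\<And>k. successively (\<lambda>a b. d a b \<le> real K) (L k)"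
      "\<And>k. d (last (L k)) (hd (L (Suc k))) \<le> real K"
    and far: "\<And>k. 0 < k \<Longrightarrow> set (L k) \<subseteq> far k"
  shows "concat_seq L \<in> coarse_seqs X (bounded_coarse X d) \<xi>"
  unfolding coarse_seqs_iff
proof (intro conjI allI)
  show "range (concat_seq L) \<subseteq> X"
    using concat_seq_in_tail[of L 0, OF ne] X by fastforce
  show "concat_seq L 0 = \<xi>"
    using concat_seq_0 ne hd by metis
  show "\<exists>k. \<forall>m. d (concat_seq L m) (concat_seq L (Suc m)) \<le> real k"
    using concat_seq_step[of L "\<lambda>a b. d a b \<le> real K", OF ne step] by blast
  show "\<exists>m. \<forall>a\<ge>m. concat_seq L a \<in> far n" for n
  proof (intro exI allI impI)
    fix a assume "(\<Sum>i<Suc n. length (L i)) \<le> a"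
    then obtain k where "Suc n \<le> k" "concat_seq L a \<in> set (L k)"
      using concat_seq_in_tail[of L, OF ne] by blast
    then show "concat_seq L a \<in> far n"
      using far[of k] far_antimono[of n k] by auto
  qed
qed

lemma coarse_seq_of_linked:
  assumes f: "\<And>n. (f n, f (Suc n)) \<in> linked n"
  obtains s where "s \<in> coarse_seqs X (bounded_coarse X d) \<xi>"
    and "\<And>n. \<exists>m. \<forall>a\<ge>m. (f n, s a) \<in> linked n"
proof -
  have "\<exists>c. chain_list n (f n) (f (Suc n)) c" for n
    using f linked_listE by metis
  then obtain c where c: "\<And>n. chain_list n (f n) (f (Suc n)) (c n)"
    by metis
  define L where "L n = (if n = 0 then \<xi> # c 0 else c n)" for n
  \<comment> \<open>The bound covers both the initial jump from the basepoint to \<open>f 0\<close>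
    and the unit steps of the chains.\<close>
  obtain K where K: "d \<xi> (f 0) + 1 \<le> real K"
    using real_arch_simple by blast
  have K1: "1 \<le> real K"
    using K nonneg[of \<xi> "f 0"] by linarith
  have fX: "f n \<in> far n" for n
    using f linked_far by auto
  have ne: "L k \<noteq> []" for k
    using c[of k] by (auto simp: L_def chain_list_def)
  have cK: "successively (\<lambda>a b. d a b \<le> real K) (c k)" for k
    using c[of k] K1 unfolding chain_list_def by (auto elim!: successively_mono)
  have in_c: "(f k, x) \<in> linked k" if "x \<in> set (c k)" for k x
    using c[of k] that unfolding chain_list_def by (metis hd_in_set linked_listI)
  have "concat_seq L \<in> coarse_seqs X (bounded_coarse X d) \<xi>"
  proof (rule concat_seq_coarse[OF ne])
    show "set (L k) \<subseteq> X" for k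
      using c[of k] far_subset[of k] basepoint by (auto simp: L_def chain_list_def)
    show "hd (L 0) = \<xi>"
      by (simp add: L_def)
    show "successively (\<lambda>a b. d a b \<le> real K) (L k)" for k
      using cK c[of k] K by (auto simp: L_def successively_Cons chain_list_def)
    \<comment> \<open>The point \<open>f (Suc k)\<close> ends one block and starts the next, so the
      junction has length 0.\<close>
    show "d (last (L k)) (hd (L (Suc k))) \<le> real K" for k
    proof -
      have "last (L k) = f (Suc k)" "hd (L (Suc k)) = f (Suc k)"
        using c[of k] c[of "Suc k"] by (auto simp: L_def chain_list_def)
      then show ?thesis
        using fX[of "Suc k"] far_subset[of "Suc k"] K1 by auto
    qed
    show "set (L k) \<subseteq> far k" if "0 < k" for k
      using c[of k] that by (auto simp: L_def chain_list_def)
  qed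
  moreover have "\<exists>m. \<forall>a\<ge>m. (f n, concat_seq L a) \<in> linked n" for n
  proof (intro exI allI impI)
    fix a assume "(\<Sum>i<Suc n. length (L i)) \<le> a"
    then obtain k where k: "Suc n \<le> k" "concat_seq L a \<in> set (L k)"
      using concat_seq_in_tail[of L, OF ne] by blast
    have "(f n, f (n + j)) \<in> linked n" for j
    proof (induction j)
      case 0
      then show ?case
        using fX linked_refl by simp
    next
      case (Suc j)
      then show ?case
        using f[of "n + j"] linked_antimono[of n "n + j"] linked_trans by auto
    qed
    then have "(f n, f k) \<in> linked n"
      using k(1) by (metis Suc_leD le_add_diff_inverse)
    moreover have "(f k, concat_seq L a) \<in> linked n"
      using in_c[of "concat_seq L a" k] k linked_antimono[of n k] by (auto simp: L_def)
    ultimately show "(f n, concat_seq L a) \<in> linked n"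
      by (rule linked_trans)
  qed
  ultimately show ?thesis
    using that by blast
qed

text \<open>The common supersequence zigzags: it follows \<open>s\<close> from \<open>i k\<close> to \<open>i (k + 1)\<close>, walks back,
  crosses over to \<open>t\<close>, follows \<open>t\<close> from \<open>i k\<close> to \<open>i (k + 1)\<close> and crosses back to \<open>s\<close>. Walking back
  is needed because omitting segments of \<open>s\<close> could destroy bornologicity.\<close>

lemma coend_common_superseq:
  assumes s: "s \<in> coarse_seqs X (bounded_coarse X d) \<xi>"
    and t: "t \<in> coarse_seqs X (bounded_coarse X d) \<xi>"
    and "coend s t"
  obtains w where "w \<in> coarse_seqs X (bounded_coarse X d) \<xi>" "is_subseq s w" "is_subseq t w"
proof -
  have s0: "s 0 = \<xi>" and t0: "t 0 = \<xi>" and sX: "\<And>m. s m \<in> X" and tX: "\<And>m. t m \<in> X"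
    using s t unfolding coarse_seqs_iff by auto
  obtain Ks Kt where Ks: "\<And>m. d (s m) (s (Suc m)) \<le> real Ks"
    and Kt: "\<And>m. d (t m) (t (Suc m)) \<le> real Kt"
    using s t unfolding coarse_seqs_iff by blast
  \<comment> \<open>The successor makes \<open>K\<close> at least 1, so that it also bounds the
    steps of the crossing chains.\<close>
  define K where "K = Suc (max Ks Kt)"
  have K: "d (s m) (s (Suc m)) \<le> real K" "d (t m) (t (Suc m)) \<le> real K" for m
    using Ks[of m] Kt[of m] by (auto simp: K_def)
  obtain M where M: "\<And>n a b. a \<ge> M n \<Longrightarrow> b \<ge> M n \<Longrightarrow> (s a, t b) \<in> linked n"
    using \<open>coend s t\<close> unfolding coend_def by metis
  \<comment> \<open>The turning points increase strictly, and for positive \<open>k\<close> all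
    terms of \<open>s\<close> from \<open>i k\<close> on are \<open>linked k\<close> to all terms of
    \<open>t\<close> from \<open>i k\<close> on.\<close>
  define i where "i = rec_nat 0 (\<lambda>k r. max (Suc r) (M (Suc k)))"
  have i0: "i 0 = 0" and iS: "i (Suc k) = max (Suc (i k)) (M (Suc k))" for k
    by (simp_all add: i_def)
  have mono: "strict_mono i"
    unfolding strict_mono_Suc_iff iS by (simp add: less_max_iff_disj)
  have iM: "M k \<le> i k" if "0 < k" for k
    using that iS by (cases k) auto
  \<comment> \<open>At \<open>k = 0\<close> both sequences are at the basepoint, which no
    \<open>linked n\<close> relates to anything; the crossing there is the one-point list.\<close>
  have "\<exists>c. c \<noteq> [] \<and> hd c = s (i k) \<and> last c = t (i k) \<and> set c \<subseteq> X \<and>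
      (0 < k \<longrightarrow> set c \<subseteq> far k) \<and> successively (\<lambda>a b. d a b \<le> real K) c" for k
  proof (cases "k = 0")
    case True
    then show ?thesis
      using s0 t0 i0 basepoint by (intro exI[of _ "[\<xi>]"]) simp
  next
    case False
    then have "(s (i k), t (i k)) \<in> linked k"
      using M iM by simp
    then obtain c where "chain_list k (s (i k)) (t (i k)) c"
      using linked_listE by blast
    then show ?thesis
      using far_subset[of k] unfolding chain_list_def
      by (intro exI[of _ c]) (auto simp: K_def elim!: successively_mono)
  qed
  then obtain c where c: "\<And>k. c k \<noteq> []" "\<And>k. hd (c k) = s (i k)" "\<And>k. last (c k) = t (i k)"
      "\<And>k. set (c k) \<subseteq> X" "\<And>k. 0 < k \<Longrightarrow> set (c k) \<subseteq> far k"
      "\<And>k. successively (\<lambda>a b. d a b \<le> real K) (c k)"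
    by metis
  define S where "S k = map s [i k..<i (Suc k)]" for k
  define T where "T k = map t [i k..<i (Suc k)]" for k
  \<comment> \<open>Every junction, within a block or between two blocks, repeats a point, except
    the one from \<open>T k\<close> to \<open>rev (c (Suc k))\<close>, which is a step of
    \<open>t\<close>.\<close>
  define L where "L k = S k @ rev (S k) @ c k @ T k @ rev (c (Suc k))" for k
  have less: "i k < i (Suc k)" for k
    using mono by (simp add: strict_mono_less)
  have S_ne: "S k \<noteq> []" and T_ne: "T k \<noteq> []" for k
    using less[of k] by (simp_all add: S_def T_def)
  have hd_ends: "hd (S k) = s (i k)" "hd (T k) = t (i k)" for k
    using less[of k] by (simp_all add: S_def T_def hd_map)
  have last_T: "last (T k) = t (i (Suc k) - 1)" for k
    using less[of k] by (simp add: T_def last_map)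
  have SX: "set (S k) \<subseteq> X" and TX: "set (T k) \<subseteq> X" for k
    using sX tX by (auto simp: S_def T_def)
  have steps: "successively (\<lambda>a b. d a b \<le> real K) (S k)"
    "successively (\<lambda>a b. d a b \<le> real K) (T k)" for k
    using K by (auto simp: S_def T_def successively_conv_nth)
  have far: "set (L k) \<subseteq> far k" if "0 < k" for k
  proof -
    have "(s a, t b) \<in> linked k" if "i k \<le> a" "i k \<le> b" for a b
      using M iM[OF \<open>0 < k\<close>] that by simp
    then have "s a \<in> far k \<and> t a \<in> far k" if "i k \<le> a" for a
      using linked_far[of k] that by blast
    moreover have "set (c (Suc k)) \<subseteq> far k"
      using c(5)[of "Suc k"] far_antimono[of k "Suc k"] by auto
    ultimately show ?thesis
      using c(5)[OF that] by (auto simp: L_def S_def T_def)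
  qed
  have "concat_seq L \<in> coarse_seqs X (bounded_coarse X d) \<xi>"
  proof (rule concat_seq_coarse)
    show "L k \<noteq> []" for k
      by (simp add: L_def S_ne)
    show "set (L k) \<subseteq> X" for k
      using SX TX c(4) by (auto simp: L_def)
    show "hd (L 0) = \<xi>"
      by (simp add: L_def S_ne hd_ends i0 s0)
    have last_T': "d (last (T k)) (t (i (Suc k))) \<le> real K" for k
      using K(2)[of "i (Suc k) - 1"] less[of k] last_T[of k] by simp
    have "d (last (S k)) (last (S k)) \<le> real K" for k
      using SX[of k] S_ne[of k] last_in_set by fastforce
    then show "successively (\<lambda>a b. d a b \<le> real K) (L k)" for k
      using steps c S_ne T_ne hd_ends last_T' sX tX
      by (simp add: L_def successively_append_iff hd_rev last_rev commute hd_append)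
    show "d (last (L k)) (hd (L (Suc k))) \<le> real K" for k
      using c S_ne sX by (simp add: L_def last_rev hd_ends)
    show "set (L k) \<subseteq> far k" if "0 < k" for k
      by (rule far[OF that])
  qed
  moreover have "is_subseq s (concat_seq L)"
    by (rule is_subseq_concat_seq[OF mono i0,
          where A = "\<lambda>k. []" and B = "\<lambda>k. rev (S k) @ c k @ T k @ rev (c (Suc k))"])
      (simp add: L_def S_def)
  moreover have "is_subseq t (concat_seq L)"
    by (rule is_subseq_concat_seq[OF mono i0,
          where A = "\<lambda>k. S k @ rev (S k) @ c k" and B = "\<lambda>k. rev (c (Suc k))"])
      (simp add: L_def T_def)
  ultimately show ?thesis
    using that by blast
qed

text \<open>On coarse sequences \<open>coend\<close> is an equivalence relation containing the
  subsequence relation, so it contains the equivalence generated by it. Conversely, a zigzag of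
  length 2 through a common supersequence suffices.\<close>

lemma sigma_rel_iff:
  assumes "s \<in> coarse_seqs X (bounded_coarse X d) \<xi>"
  shows "(s, t) \<in> sigma_rel X (bounded_coarse X d) \<xi> \<longleftrightarrow>
    t \<in> coarse_seqs X (bounded_coarse X d) \<xi> \<and> coend s t"
proof
  assume "(s, t) \<in> sigma_rel X (bounded_coarse X d) \<xi>"
  then obtain n and u :: "nat \<Rightarrow> nat \<Rightarrow> 'a" where u: "u 0 = s" "u n = t"
      "\<And>i. i \<le> n \<Longrightarrow> u i \<in> coarse_seqs X (bounded_coarse X d) \<xi>"
      "\<And>i. i < n \<Longrightarrow> is_subseq (u i) (u (Suc i)) \<or> is_subseq (u (Suc i)) (u i)"
    unfolding sigma_rel_def by blast
  have "coend s (u i)" if "i \<le> n" for i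
    using that
  proof (induction i)
    case 0
    then show ?case
      using u(1) coend_refl assms by simp
  next
    case (Suc i)
    then have "coend (u i) (u (Suc i))"
      using u(3)[of i] u(3)[of "Suc i"] u(4)[of i] coend_subseq coend_sym by (metis Suc_le_lessD less_imp_le)
    then show ?case
      using Suc coend_trans by auto
  qed
  then show "t \<in> coarse_seqs X (bounded_coarse X d) \<xi> \<and> coend s t"
    using u by auto
next
  assume t: "t \<in> coarse_seqs X (bounded_coarse X d) \<xi> \<and> coend s t"
  then obtain w where w: "w \<in> coarse_seqs X (bounded_coarse X d) \<xi>" "is_subseq s w" "is_subseq t w"
    using coend_common_superseq assms by blast
  define u where "u i = (if i = 0 then s else if i = 1 then w else t)" for i :: nat
  have "\<forall>i<2. is_subseq (u i) (u (Suc i)) \<or> is_subseq (u (Suc i)) (u i)"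
    using w by (auto simp: u_def less_2_cases_iff)
  then show "(s, t) \<in> sigma_rel X (bounded_coarse X d) \<xi>"
    unfolding sigma_rel_def using assms t w(1)
    by (intro CollectI case_prodI exI[of _ 2] exI[of _ u]) (auto simp: u_def)
qed

end

section \<open>Formulae for derived notions\<close>

definition Imp :: "fm \<Rightarrow> fm \<Rightarrow> fm" where
  "Imp p q = Neg (Conj p (Neg q))"

definition Iff :: "fm \<Rightarrow> fm \<Rightarrow> fm" where
  "Iff p q = Conj (Imp p q) (Imp q p)"

definition All :: "nat \<Rightarrow> fm \<Rightarrow> fm" where
  "All i p = Neg (Ex i (Neg p))"

lemma sat_Imp [simp]: "sat m e (Imp p q) \<longleftrightarrow> (sat m e p \<longrightarrow> sat m e q)"
  by (simp add: Imp_def)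

lemma sat_Iff [simp]: "sat m e (Iff p q) \<longleftrightarrow> (sat m e p \<longleftrightarrow> sat m e q)"
  by (auto simp: Iff_def)

lemma sat_All [simp]: "sat m e (All i p) \<longleftrightarrow> (\<forall>a. sat m (e(i := a)) p)"
  by (simp add: All_def)

text \<open>The bound variable exceeds all three arguments, so nothing is captured;
  \<open>Opair\<close> and \<open>Rel\<close> choose fresh variables in the same way.\<close>

definition Doubleton :: "nat \<Rightarrow> nat \<Rightarrow> nat \<Rightarrow> fm" where
  "Doubleton u x y = (let z = Suc (u + x + y) in
     All z (Iff (Mem z u) (Neg (Conj (Neg (Eq z x)) (Neg (Eq z y))))))"

lemma sat_Doubleton [simp]: "sat m e (Doubleton u x y) \<longleftrightarrow> members m (e u) = {e x, e y}"
  by (auto simp: Doubleton_def members_def Let_def)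

definition Opair :: "nat \<Rightarrow> nat \<Rightarrow> nat \<Rightarrow> fm" where
  "Opair p x y = (let u = Suc (p + x + y) in
     Ex u (Ex (Suc u) (Conj (Doubleton u x x) (Conj (Doubleton (Suc u) x y) (Doubleton p u (Suc u))))))"

lemma sat_Opair [simp]: "sat m e (Opair p x y) \<longleftrightarrow> is_opair m (e p) (e x) (e y)"
  by (auto simp: Opair_def is_opair_def Let_def)

definition Rel :: "nat \<Rightarrow> nat \<Rightarrow> nat \<Rightarrow> fm" where
  "Rel a x y = (let p = Suc (a + x + y) in Ex p (Conj (Opair p x y) (Mem p a)))"

lemma sat_Rel [simp]: "sat m e (Rel a x y) \<longleftrightarrow> (e x, e y) \<in> rel_of m (e a)"
  by (auto simp: Rel_def rel_of_def Let_def)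

lemma is_opair_inject:
  assumes "is_opair m p x y" "is_opair m p x' y'"
  shows "x = x' \<and> y = y'"
proof -
  obtain u v where uv: "members m u = {x}" "members m v = {x, y}" "members m p = {u, v}"
    using assms(1) unfolding is_opair_def by blast
  obtain u' v' where uv': "members m u' = {x'}" "members m v' = {x', y'}" "members m p = {u', v'}"
    using assms(2) unfolding is_opair_def by blast
  \<comment> \<open>The comparison takes place between HOL sets, so it is valid for any relation
    \<open>m\<close>, in particular for \<open>smem\<close>.\<close>
  have "{{x}, {x, y}} = {{x'}, {x', y'}}"
    using uv uv' by (metis image_empty image_insert)
  then show ?thesis
    by (metis Pair_inject doubleton_eq_iff insert_absorb2 singleton_insert_inj_eq')
qed

section \<open>Coding in the standard universe\<close>

context transitive_universe
begin

declare num.simps [simp del]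

lemma is_standard_subset: "is_standard B \<Longrightarrow> A \<subseteq> B \<Longrightarrow> is_standard A"
  unfolding is_standard_def using subset_closed by blast

lemma members_code [simp]:
  assumes "is_standard A"
  shows "members mem (code A) = A"
proof -
  have "\<exists>!a. members mem a = A"
    using assms extensional unfolding is_standard_def by blast
  then show ?thesis
    unfolding code_def by (rule theI')
qed

lemma mem_code [simp]: "is_standard A \<Longrightarrow> mem x (code A) \<longleftrightarrow> x \<in> A"
  using members_code[of A] by (auto simp: members_def)

lemma is_opair_iff: "is_opair mem p x y \<longleftrightarrow> p = opair x y"
proof -
  obtain u where u: "members mem u = {x}"
    using pairing[of x x] by auto
  obtain v where v: "members mem v = {x, y}"
    using pairing by blast
  obtain q where "members mem q = {u, v}"
    using pairing by blast
  then have q: "is_opair mem q x y"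
    using u v unfolding is_opair_def by blast
  have "p = q" if "is_opair mem p x y" "is_opair mem q x y" for p q
    using that extensional unfolding is_opair_def by metis
  then have "\<exists>!p. is_opair mem p x y"
    using q by blast
  then show ?thesis
    unfolding opair_def by (metis theI')
qed

lemma opair_inject [simp]: "opair x y = opair x' y' \<longleftrightarrow> x = x' \<and> y = y'"
  using is_opair_inject is_opair_iff by metis

lemma rel_of_code_rel [simp]: "is_standard (pairs E) \<Longrightarrow> rel_of mem (code_rel E) = E"
  by (auto simp: rel_of_def code_rel_def is_opair_iff pairs_def)

abbreviation "Om \<equiv> range num"
abbreviation "Le \<equiv> {(num a, num b) |a b. a \<le> b}"
abbreviation "Lt \<equiv> {(num a, num b) |a b. a < b}"
abbreviation "graph s \<equiv> range (\<lambda>k. (num k, s k))"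
abbreviation "Sc \<equiv> graph (\<lambda>k. num (Suc k))"

lemma pairs_mono: "E \<subseteq> F \<Longrightarrow> pairs E \<subseteq> pairs F"
  by (auto simp: pairs_def)

end

context standard_universe
begin

lemma is_standard_pairs: "is_standard A \<Longrightarrow> is_standard B \<Longrightarrow> E \<subseteq> A \<times> B \<Longrightarrow> is_standard (pairs E)"
  using products is_standard_subset pairs_mono by metis

lemma is_standard_singleton: "is_standard {x}"
  using pairing[of x x] by (auto simp: is_standard_def)

text \<open>Every set arising in the recursion is a subset of the standard set of all numerals, so
  \<open>code\<close> really denotes it.\<close>

lemma members_num: "members mem (num n) = num ` {..<n}"
proof (induction n)
  case 0
  then show ?case
    using is_standard_subset[OF infinity, of "{}"] by (simp add: num.simps)
next
  case (Suc n)
  have "insert (num n) (members mem (num n)) \<subseteq> range num"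
    using Suc by auto
  then have "members mem (num (Suc n)) = insert (num n) (members mem (num n))"
    using is_standard_subset[OF infinity] by (simp add: num.simps)
  then show ?case
    using Suc by (simp add: lessThan_Suc)
qed

text \<open>For \<open>m < n\<close> the numeral of \<open>m\<close> is a member of that of
  \<open>n\<close>, and well-foundedness excludes self-membership.\<close>

lemma num_inject [simp]: "num m = num n \<longleftrightarrow> m = n"
proof -
  have "num m \<noteq> num n" if "m < n" for m n
  proof
    assume "num m = num n"
    have "num m \<in> members mem (num n)"
      using members_num[of n] that by blast
    then have "mem (num m) (num m)"
      using \<open>num m = num n\<close> by (simp add: members_def)
    then show False
      using wf_irrefl[OF well_founded] by auto
  qed
  then show ?thesis
    by (metis linorder_neqE_nat)
qed

lemma graph_subset: "range s \<subseteq> X \<Longrightarrow> graph s \<subseteq> Om \<times> X"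
  by auto

lemma is_standard_graph: "is_standard X \<Longrightarrow> range s \<subseteq> X \<Longrightarrow> is_standard (pairs (graph s))"
  by (rule is_standard_pairs[OF infinity, of X]) auto

lemma is_standard_Le: "is_standard (pairs Le)"
  by (rule is_standard_pairs[OF infinity infinity]) blast

lemma is_standard_Sc: "is_standard (pairs Sc)"
  by (rule is_standard_graph[OF infinity]) blast

end

section \<open>Transfer of operations on sets and relations\<close>

context nonstandard_extension
begin

lemma mem_star_code [simp]: "smem x (star (code A)) \<longleftrightarrow> x \<in> star_set A"
  by (simp add: star_set_def members_def)

lemma rel_of_star_code_rel [simp]: "rel_of smem (star (code_rel E)) = star_rel E"
  by (simp add: star_rel_def)

text \<open>In applications of \<open>elementary\<close>, the assignment \<open>(!) [a, b, \<dots>]\<close> makes the listed elements the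
  values of the variables 0, 1, \<open>\<dots>\<close>; an entry \<open>undefined\<close> stands for a variable that the formula
  quantifies.\<close>

lemma star_in_star_set [simp]: "is_standard A \<Longrightarrow> star a \<in> star_set A \<longleftrightarrow> a \<in> A"
  using elementary[of "(!) [a, code A]"
        "Mem 0 1"] by simp

lemma star_in_star_rel [simp]:
  "is_standard (pairs E) \<Longrightarrow> (star a, star b) \<in> star_rel E \<longleftrightarrow> (a, b) \<in> E"
  using elementary[of "(!) [a, b, code_rel E]"
        "Rel 2 0 1"] by simp

lemma star_set_Un:
  assumes "is_standard (A \<union> B)"
  shows "star_set (A \<union> B) = star_set A \<union> star_set B"
proof -
  have "is_standard A" "is_standard B"
    using assms by (auto intro: is_standard_subset)
  then show ?thesis
    using elementary[of "(!) [code (A \<union> B), code A, code B]"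
        "All 3 (Iff (Mem 3 0) (Imp (Neg (Mem 3 1)) (Mem 3 2)))"] assms by auto
qed

lemma star_set_mono: "is_standard B \<Longrightarrow> A \<subseteq> B \<Longrightarrow> star_set A \<subseteq> star_set B"
  using star_set_Un[of A B] by (simp add: sup_absorb2) blast

lemma star_set_singleton: "star_set {a} = {star a}"
  using elementary[of "(!) [code {a}, a]"
        "All 3 (Iff (Mem 3 0) (Eq 3 1))"] is_standard_singleton[of a]
  by auto

lemma star_set_empty: "star_set {} = {}"
  using elementary[of "(!) [code {}]"
        "All 3 (Neg (Mem 3 0))"]
    is_standard_subset[OF is_standard_singleton, of "{}"] by auto

text \<open>This is what makes the finitely many points of \<open>finite_representatives\<close>
  remain standard after transfer.\<close>

lemma star_set_finite:
  assumes "finite F" "is_standard F"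
  shows "star_set F = star ` F"
  using assms
proof (induction F)
  case (insert a F)
  then have "star_set ({a} \<union> F) = star_set {a} \<union> star_set F"
    by (intro star_set_Un) simp
  then show ?case
    using insert is_standard_subset[of "insert a F" F] by (auto simp: star_set_singleton)
qed (simp add: star_set_empty)

text \<open>With this and the following rules many transfers become relation algebra, without a
  separate formula for each.\<close>

lemma star_rel_mono:
  assumes "is_standard (pairs F)" "E \<subseteq> F"
  shows "star_rel E \<subseteq> star_rel F"
proof -
  have "is_standard (pairs E)"
    using assms pairs_mono is_standard_subset by metis
  then show ?thesis
    using elementary[of "(!) [code_rel E, code_rel F]"
        "All 3 (All 4 (Imp (Rel 0 3 4) (Rel 1 3 4)))"]
      assms by auto
qed

lemma star_rel_Times:
  assumes "is_standard A" "is_standard B"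
  shows "star_rel (A \<times> B) = star_set A \<times> star_set B"
  using elementary[of "(!) [code_rel (A \<times> B), code A, code B]"
        "All 3 (All 4 (Iff (Rel 0 3 4) (Conj (Mem 3 1) (Mem 4 2))))"] assms products by auto

lemma star_rel_subset_Times:
  assumes "is_standard A" "is_standard B" "E \<subseteq> A \<times> B"
  shows "star_rel E \<subseteq> star_set A \<times> star_set B"
  using star_rel_mono[OF products] star_rel_Times assms by metis

lemma star_rel_Int:
  assumes "is_standard (pairs E)" "is_standard (pairs F)"
  shows "star_rel (E \<inter> F) = star_rel E \<inter> star_rel F"
proof -
  have "is_standard (pairs (E \<inter> F))"
    using assms pairs_mono[of "E \<inter> F" E] is_standard_subset by blast
  then show ?thesis
    using elementary[of "(!) [code_rel (E \<inter> F), code_rel E, code_rel F]"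
        "All 3 (All 4 (Iff (Rel 0 3 4) (Conj (Rel 1 3 4) (Rel 2 3 4))))"] assms by auto
qed

lemma star_rel_empty: "star_rel {} = {}"
  using star_rel_subset_Times[of "{}" "{}" "{}"] is_standard_subset[OF infinity, of "{}"]
  by (auto simp: star_set_empty)

lemma star_rel_relcomp:
  assumes "is_standard A" "is_standard A'" "is_standard A''" "E \<subseteq> A \<times> A'" "F \<subseteq> A' \<times> A''"
  shows "star_rel (E O F) = star_rel E O star_rel F"
proof -
  have "E O F \<subseteq> A \<times> A''"
    using assms by auto
  then have "is_standard (pairs E)" "is_standard (pairs F)" "is_standard (pairs (E O F))"
    using assms is_standard_pairs by simp_all
  then show ?thesis
    using elementary[of "(!) [code_rel (E O F), code_rel E, code_rel F]"
        "All 3 (All 4 (Iff (Rel 0 3 4) (Ex 5 (Conj (Rel 1 3 5) (Rel 2 5 4)))))"]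
    by (simp add: relcomp_unfold set_eq_iff)
qed

lemma star_rel_converse:
  assumes "is_standard A" "is_standard B" "E \<subseteq> A \<times> B"
  shows "star_rel (E\<inverse>) = (star_rel E)\<inverse>"
proof -
  have "is_standard (pairs E)" "is_standard (pairs (E\<inverse>))"
    using assms by (auto intro: is_standard_pairs)
  then show ?thesis
    using elementary[of "(!) [code_rel (E\<inverse>), code_rel E]"
        "All 3 (All 4 (Iff (Rel 0 3 4) (Rel 1 4 3)))"] by auto
qed

lemma star_rel_Id_on:
  assumes "is_standard A"
  shows "star_rel (Id_on A) = Id_on (star_set A)"
proof -
  have "is_standard (pairs (Id_on A))"
    using assms by (auto intro: is_standard_pairs)
  then show ?thesis
    using elementary[of "(!) [code_rel (Id_on A), code A]"
        "All 3 (All 4 (Iff (Rel 0 3 4) (Conj (Mem 3 1) (Eq 3 4))))"] assms by (auto simp: Id_on_iff)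
qed

lemma star_set_Domain:
  assumes "is_standard A" "is_standard B" "E \<subseteq> A \<times> B"
  shows "star_set (Domain E) = Domain (star_rel E)"
proof -
  have "is_standard (pairs E)" "is_standard (Domain E)"
    using assms by (auto intro: is_standard_pairs is_standard_subset)
  then show ?thesis
    using elementary[of "(!) [code (Domain E), code_rel E]"
        "All 3 (Iff (Mem 3 0) (Ex 4 (Rel 1 3 4)))"] by (auto simp: Domain_iff)
qed

section \<open>Hypernaturals and extended sequences\<close>

text \<open>Totality is an equation for the domain and single-valuedness the inclusion of
  \<open>(graph s)\<inverse> O graph s\<close> in the identity; both transfer by the rules for
  relations, and together they justify the description operator behind
  \<open>star_seq\<close>.\<close>

lemma star_rel_graph:
  assumes "is_standard X" "range s \<subseteq> X"
  shows "(i, x) \<in> star_rel (graph s) \<longleftrightarrow> i \<in> hypernats \<and> x = star_seq s i"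
proof -
  have "Domain (graph s) = Om"
    by auto
  then have dom: "Domain (star_rel (graph s)) = hypernats"
    using star_set_Domain[OF infinity assms(1) graph_subset[OF assms(2)]] by (simp add: hypernats_def)
  have "(graph s)\<inverse> O graph s \<subseteq> Id_on X"
    using assms(2) by auto
  then have "star_rel ((graph s)\<inverse> O graph s) \<subseteq> Id_on (star_set X)"
    using star_rel_mono[of "Id_on X"] star_rel_Id_on assms(1)
      is_standard_pairs[OF assms(1) assms(1), of "Id_on X"] by auto
  moreover have "star_rel ((graph s)\<inverse> O graph s) = (star_rel (graph s))\<inverse> O star_rel (graph s)"
    using star_rel_relcomp[OF assms(1) infinity assms(1), of "(graph s)\<inverse>" "graph s"]
      star_rel_converse[OF infinity assms(1), of "graph s"] assms(2) by auto
  ultimately have unique: "x = y"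
    if "(i, x) \<in> star_rel (graph s)" "(i, y) \<in> star_rel (graph s)" for i x y
    using that by blast
  have "(i, star_seq s i) \<in> star_rel (graph s)" if i: "i \<in> hypernats" for i
  proof -
    obtain x where "(i, x) \<in> star_rel (graph s)"
      using i dom by blast
    then have "\<exists>!x. (i, x) \<in> star_rel (graph s)"
      using unique by blast
    then show ?thesis
      unfolding star_seq_def app_def by (rule theI')
  qed
  then show ?thesis
    using dom unique by blast
qed

lemma star_seq_const:
  assumes "i \<in> hypernats"
  shows "star_seq (\<lambda>_. a) i = star a"
proof -
  have "graph (\<lambda>_. a) = Om \<times> {a}"
    by auto
  then have "star_rel (graph (\<lambda>_. a)) = hypernats \<times> {star a}"
    using star_rel_Times[OF infinity is_standard_singleton[of a]]
    by (simp add: hypernats_def star_set_singleton)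
  then show ?thesis
    using star_rel_graph[OF is_standard_singleton[of a], of "\<lambda>_. a" i "star a"] assms by auto
qed

text \<open>Only finitely many numerals lie below \<open>m\<close>, and their set gains no new
  elements, so an infinite index falls in the extension of the rest.\<close>

lemma infinite_hypernats_star_set:
  assumes "i \<in> infinite_hypernats"
  shows "i \<in> star_set (num ` {m..})"
proof -
  have *: "Om = num ` {m..} \<union> num ` {..<m}"
    by (force simp: image_iff)
  then have "hypernats = star_set (num ` {m..}) \<union> star_set (num ` {..<m})"
    unfolding hypernats_def using star_set_Un infinity by metis
  moreover have "star_set (num ` {..<m}) \<subseteq> star ` Om"
    using star_set_finite[of "num ` {..<m}"] is_standard_subset[OF infinity, of "num ` {..<m}"] by auto
  ultimately show ?thesis
    using assms unfolding infinite_hypernats_def by blast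
qed

text \<open>The pair \<open>(i, j)\<close> lies in the extension of the square of every final
  segment of the numerals. A relation that holds on such a square therefore holds at
  \<open>(i, j)\<close>, and one that fails throughout the square fails at
  \<open>(i, j)\<close>.\<close>

lemma
  assumes X: "is_standard X" "range s \<subseteq> X" "range t \<subseteq> X" and R: "R \<subseteq> X \<times> X"
    and inf: "i \<in> infinite_hypernats" "j \<in> infinite_hypernats"
  shows star_seq_relI:
      "\<forall>a\<ge>m. \<forall>b\<ge>m. (s a, t b) \<in> R \<Longrightarrow> (star_seq s i, star_seq t j) \<in> star_rel R"
    and star_seq_relD:
      "(star_seq s i, star_seq t j) \<in> star_rel R \<Longrightarrow> \<exists>a\<ge>m. \<exists>b\<ge>m. (s a, t b) \<in> R"
proof -
  \<comment> \<open>The index pairs whose values are related by \<open>R\<close>, written as a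
    composite so that its extension can be computed.\<close>
  define P where "P = graph s O R O (graph t)\<inverse>"
  define M where "M = num ` {m..}"
  have stdM: "is_standard M"
    unfolding M_def by (rule is_standard_subset[OF infinity]) auto
  have in_P: "(num a, num b) \<in> P \<longleftrightarrow> (s a, t b) \<in> R" for a b
    by (auto simp: P_def)
  have P: "P \<subseteq> Om \<times> Om"
    by (auto simp: P_def)
  have "star_rel (R O (graph t)\<inverse>) = star_rel R O (star_rel (graph t))\<inverse>"
    using star_rel_relcomp[OF X(1) X(1) infinity R, of "(graph t)\<inverse>"]
      star_rel_converse[OF infinity X(1) graph_subset[OF X(3)]] X(3) by auto
  then have "star_rel P = star_rel (graph s) O star_rel R O (star_rel (graph t))\<inverse>"
    unfolding P_def
    using star_rel_relcomp[OF infinity X(1) infinity graph_subset[OF X(2)], of "R O (graph t)\<inverse>"] R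
    by auto
  then have star_P: "(i, j) \<in> star_rel P \<longleftrightarrow> (star_seq s i, star_seq t j) \<in> star_rel R"
    using star_rel_graph[OF X(1,2)] star_rel_graph[OF X(1,3)] inf
    by (auto simp: infinite_hypernats_def relcomp_unfold)
  have ij: "(i, j) \<in> star_rel (M \<times> M)"
    using infinite_hypernats_star_set inf stdM by (simp add: star_rel_Times M_def)
  show "(star_seq s i, star_seq t j) \<in> star_rel R" if "\<forall>a\<ge>m. \<forall>b\<ge>m. (s a, t b) \<in> R"
  proof -
    have "M \<times> M \<subseteq> P"
      using that in_P by (auto simp: M_def)
    then show ?thesis
      using ij star_P star_rel_mono[of P "M \<times> M"] is_standard_pairs[OF infinity infinity P] by blast
  qed
  show "\<exists>a\<ge>m. \<exists>b\<ge>m. (s a, t b) \<in> R" if "(star_seq s i, star_seq t j) \<in> star_rel R"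
  proof (rule ccontr)
    assume "\<not> ?thesis"
    then have "M \<times> M \<inter> P = {}"
      using in_P by (auto simp: M_def)
    then have "star_rel (M \<times> M) \<inter> star_rel P = {}"
      using star_rel_Int[of "M \<times> M" P] products[OF stdM stdM] is_standard_pairs[OF infinity infinity P]
      by (simp add: star_rel_empty)
    then show False
      using that ij star_P by blast
  qed
qed

text \<open>The numerals serve as the standard index set, with \<open>inv num\<close> translating
  back. For a decreasing sequence a finite intersection contains one of the terms, so nonempty terms
  give the finite intersection property.\<close>

lemma decreasing_saturation:
  fixes A :: "nat \<Rightarrow> 'v"
  assumes ne: "\<And>n. members smem (A n) \<noteq> {}"
    and dec: "\<And>n. members smem (A (Suc n)) \<subseteq> members smem (A n)"
  obtains x where "\<And>n. smem x (A n)"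
proof -
  have anti: "members smem (A n) \<subseteq> members smem (A m)" if "m \<le> n" for m n
    using that dec by (rule lift_Suc_antimono_le[rotated])
  have "(\<Inter>i \<in> members mem (code Om). members smem (A (inv num i))) \<noteq> {}"
  proof (rule saturated)
    fix F assume F: "finite F" "F \<subseteq> members mem (code Om)"
    obtain n where n: "\<And>i. i \<in> F \<Longrightarrow> inv num i \<le> n"
      using F(1) finite_nat_set_iff_bounded_le[of "inv num ` F"] by auto
    have "members smem (A n) \<subseteq> (\<Inter>i\<in>F. members smem (A (inv num i)))"
      using anti n by blast
    then show "(\<Inter>i\<in>F. members smem (A (inv num i))) \<noteq> {}"
      using ne[of n] by blast
  qed
  then obtain x where "\<And>n. x \<in> members smem (A (inv num (num n)))"
    using infinity by auto
  moreover have "inv num (num n) = n" for n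
    by (rule inv_f_f) (simp add: inj_def)
  ultimately show ?thesis
    using that[of x] by (simp add: members_def)
qed

lemma infinite_hypernats_nonempty: "infinite_hypernats \<noteq> {}"
proof -
  have std: "is_standard (num ` {n..})" for n
    by (rule is_standard_subset[OF infinity]) auto
  obtain i where "\<And>n. smem i (star (code (num ` {n..})))"
  proof (rule decreasing_saturation[of "\<lambda>n. star (code (num ` {n..}))"])
    show "members smem (star (code (num ` {n..}))) \<noteq> {}" for n
      using star_in_star_set[OF std[of n], of "num n"] by (auto simp: members_def)
    show "members smem (star (code (num ` {Suc n..}))) \<subseteq> members smem (star (code (num ` {n..})))"
      for n
      using star_set_mono[OF std[of n], of "num ` {Suc n..}"] image_mono[of "{Suc n..}" "{n..}" num]
      by (auto simp: members_def)
  qed blast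
  then have i: "i \<in> star_set (num ` {n..})" for n
    by simp
  have "i \<in> hypernats"
    unfolding hypernats_def using i[of 0] star_set_mono[OF infinity, of "num ` {0..}"] by auto
  moreover have "i \<noteq> star (num n)" for n
    using i[of "Suc n"] std by auto
  ultimately show ?thesis
    unfolding infinite_hypernats_def by blast
qed

end

section \<open>Hyperfinite chains\<close>

text \<open>The parameters \<open>om\<close>, \<open>le\<close>, \<open>sc\<close> and
  \<open>z\<close> stand for the naturals, their order, successor and zero; \<open>h\<close> is a
  function on the indices up to \<open>n\<close> with values in \<open>Y\<close>, steps in
  \<open>E\<close>, and ends \<open>x\<close> and \<open>y\<close>. It is phrased for an arbitrary
  membership relation so that the single formula \<open>Chain\<close> expresses it in both
  structures.\<close>

definition is_chain ::
  "('m \<Rightarrow> 'm \<Rightarrow> bool) \<Rightarrow> 'm \<Rightarrow> 'm \<Rightarrow> 'm \<Rightarrow> 'm \<Rightarrow> 'm \<Rightarrow> 'm \<Rightarrow> 'm \<Rightarrow> 'm \<Rightarrow> 'm \<Rightarrow> 'm \<Rightarrow> bool" where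
  "is_chain m om le sc z E Y h n x y \<longleftrightarrow>
     m n om \<and>
     (\<forall>p. m p h \<longrightarrow> (\<exists>i v. is_opair m p i v \<and> (i, n) \<in> rel_of m le)) \<and>
     (\<forall>i. (i, n) \<in> rel_of m le \<longrightarrow> (\<exists>v. (i, v) \<in> rel_of m h \<and> (\<forall>v'. (i, v') \<in> rel_of m h \<longrightarrow> v' = v))) \<and>
     (z, x) \<in> rel_of m h \<and> (n, y) \<in> rel_of m h \<and>
     (\<forall>i v. (i, v) \<in> rel_of m h \<longrightarrow> m v Y) \<and>
     (\<forall>i i' v v'. (i, i') \<in> rel_of m sc \<and> (i, v) \<in> rel_of m h \<and> (i', v') \<in> rel_of m h \<longrightarrow>
        (v, v') \<in> rel_of m E)"

text \<open>The arguments of \<^const>\<open>is_chain\<close> after the first are the variables 0 to 9.\<close>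

definition Chain :: fm where
  "Chain =
     Conj (Mem 7 0)
     (Conj (All 20 (Imp (Mem 20 6) (Ex 21 (Ex 22 (Conj (Opair 20 21 22) (Rel 1 21 7))))))
     (Conj (All 21 (Imp (Rel 1 21 7) (Ex 22 (Conj (Rel 6 21 22) (All 23 (Imp (Rel 6 21 23) (Eq 23 22)))))))
     (Conj (Rel 6 3 8) (Conj (Rel 6 7 9)
     (Conj (All 21 (All 22 (Imp (Rel 6 21 22) (Mem 22 5))))
       (All 21 (All 22 (All 23 (All 24
         (Imp (Conj (Rel 2 21 22) (Conj (Rel 6 21 23) (Rel 6 22 24))) (Rel 4 23 24)))))))))))"

lemma sat_Chain [simp]:
  "sat m e Chain \<longleftrightarrow> is_chain m (e 0) (e 1) (e 2) (e 3) (e 4) (e 5) (e 6) (e 7) (e 8) (e 9)"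
  by (simp add: Chain_def is_chain_def)

context standard_universe
begin

text \<open>In the standard universe every member of \<open>code Om\<close> is a numeral, so a coded
  chain is an ordinary finite one.\<close>

lemma is_chainE:
  assumes "is_chain mem (code Om) (code_rel Le) (code_rel Sc) (num 0) E Y h n x y"
  obtains N f where "f 0 = x" "f N = y" "\<And>i. i \<le> N \<Longrightarrow> mem (f i) Y"
    "\<And>i. i < N \<Longrightarrow> (f i, f (Suc i)) \<in> rel_of mem E"
proof -
  note Om = is_standard_Le is_standard_Sc
  have n: "n \<in> Om"
    using assms infinity by (simp add: is_chain_def)
  then obtain N where N: "n = num N"
    by blast
  have fn: "\<exists>v. (num i, v) \<in> rel_of mem h \<and> (\<forall>v'. (num i, v') \<in> rel_of mem h \<longrightarrow> v' = v)"
    if "i \<le> N" for i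
    using assms Om that N by (simp add: is_chain_def)
  then obtain f where f: "\<And>i. i \<le> N \<Longrightarrow> (num i, f i) \<in> rel_of mem h"
    by metis
  have unique: "v = f i" if "i \<le> N" "(num i, v) \<in> rel_of mem h" for i v
    using fn[OF that(1)] f[OF that(1)] that(2) by blast
  have 1: "(num 0, x) \<in> rel_of mem h" "(num N, y) \<in> rel_of mem h"
    using assms N by (simp_all add: is_chain_def)
  have 2: "mem v Y" if "(i, v) \<in> rel_of mem h" for i v
    using assms that by (auto simp: is_chain_def)
  have 3: "(v, v') \<in> rel_of mem E"
    if "(num i, v) \<in> rel_of mem h" "(num (Suc i), v') \<in> rel_of mem h" for i v v'
  proof -
    have "(num i, num (Suc i)) \<in> rel_of mem (code_rel Sc)"
      using Om by simp
    then show ?thesis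
      using assms that unfolding is_chain_def by blast
  qed
  show ?thesis
  proof (rule that[of f N])
    show "f 0 = x" "f N = y"
      using unique 1 by auto
    show "mem (f i) Y" if "i \<le> N" for i
      using 2 f that by blast
    show "(f i, f (Suc i)) \<in> rel_of mem E" if "i < N" for i
      using 3[OF f f] that by simp
  qed
qed

lemma is_chainI:
  assumes "is_standard Y" and "is_standard (pairs E)"
    and Y: "\<And>i. i \<le> N \<Longrightarrow> f i \<in> Y" and E: "\<And>i. i < N \<Longrightarrow> (f i, f (Suc i)) \<in> E"
  shows "\<exists>h. is_chain mem (code Om) (code_rel Le) (code_rel Sc) (num 0) (code_rel E) (code Y)
    h (num N) (f 0) (f N)"
proof -
  define H where "H = {(num i, f i) |i. i \<le> N}"
  have H: "is_standard (pairs H)"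
    by (rule is_standard_pairs[OF infinity assms(1)]) (auto simp: H_def Y)
  moreover have "\<exists>i v. p = opair i v \<and> (i, num N) \<in> Le" if "mem p (code_rel H)" for p
    using that H by (auto simp: code_rel_def pairs_def H_def)
  ultimately have "is_chain mem (code Om) (code_rel Le) (code_rel Sc) (num 0) (code_rel E) (code Y)
    (code_rel H) (num N) (f 0) (f N)"
    unfolding is_chain_def is_opair_iff using assms infinity H is_standard_Le is_standard_Sc by (auto simp: H_def less_eq_Suc_le)
  then show ?thesis ..
qed

end

context nonstandard_extension
begin

lemma hle_refl: "n \<in> hypernats \<Longrightarrow> hle n n"
proof -
  have "star_rel (Id_on Om) \<subseteq> star_rel Le"
    by (rule star_rel_mono[OF is_standard_Le]) auto
  then show "n \<in> hypernats \<Longrightarrow> hle n n"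
    using star_rel_Id_on[OF infinity] by (auto simp: hle_def hypernats_def)
qed

lemma zero_hle: "n \<in> hypernats \<Longrightarrow> hle (star (num 0)) n"
proof -
  have "star_rel ({num 0} \<times> Om) \<subseteq> star_rel Le"
    by (rule star_rel_mono[OF is_standard_Le]) (auto)
  then show "n \<in> hypernats \<Longrightarrow> hle (star (num 0)) n"
    using star_rel_Times[OF is_standard_singleton[of "num 0"] infinity]
    by (auto simp: hle_def hypernats_def star_set_singleton)
qed

lemma star_rel_Sc: "(i, i') \<in> star_rel Sc \<longleftrightarrow> i \<in> hypernats \<and> i' = hsuc i"
  using star_rel_graph[OF infinity, of "\<lambda>k. num (Suc k)"] by (auto simp: hsuc_def)

lemma hless_iff: "hless i n \<longleftrightarrow> i \<in> hypernats \<and> hle (hsuc i) n"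
proof -
  have "Lt = Sc O Le"
    by (auto simp: less_eq_Suc_le)
  then have "star_rel Lt = star_rel Sc O star_rel Le"
    using star_rel_relcomp[OF infinity infinity infinity, of Sc Le] by auto
  then show ?thesis
    unfolding hless_def hle_def by (auto simp: star_rel_Sc relcomp_unfold)
qed

lemma hless_imp_hle: "hless i n \<Longrightarrow> hle i n"
  using star_rel_mono[OF is_standard_Le, of Lt] unfolding hless_def hle_def by fastforce

lemma hyperfinite_seq_rel_iff:
  assumes "hyperfinite_seq n h"
  shows "(i, v) \<in> rel_of smem h \<longleftrightarrow> hle i n \<and> v = app (rel_of smem h) i"
proof -
  have dom: "hle i n" if "(i, v) \<in> rel_of smem h" for i v
  proof -
    obtain p where p: "is_opair smem p i v" "smem p h"
      using \<open>(i, v) \<in> rel_of smem h\<close> by (auto simp: rel_of_def)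
    then obtain i' v' where "is_opair smem p i' v'" "hle i' n"
      using assms by (auto simp: hyperfinite_seq_def members_def)
    then show ?thesis
      using is_opair_inject[OF p(1)] by blast
  qed
  have ex1: "\<exists>!v. (i, v) \<in> rel_of smem h" if "hle i n"
    using assms that by (simp add: hyperfinite_seq_def)
  then have "(i, app (rel_of smem h) i) \<in> rel_of smem h" if "hle i n"
    unfolding app_def using that by (rule_tac theI') blast
  then show ?thesis
    using dom ex1 by blast
qed

text \<open>Connects the relational form of a chain, which is first order and can be transferred,
  with the functional form via \<open>app\<close> that occurs in \<open>iota_rel\<close>.\<close>

lemma is_chain_star_iff:
  "is_chain smem (star (code Om)) (star (code_rel Le)) (star (code_rel Sc)) (star (num 0)) E Y h n x y
   \<longleftrightarrow> hyperfinite_seq n h \<and> app (rel_of smem h) (star (num 0)) = x \<and> app (rel_of smem h) n = y \<and>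
     (\<forall>i. hle i n \<longrightarrow> smem (app (rel_of smem h) i) Y) \<and>
     (\<forall>i. hless i n \<longrightarrow>
        (app (rel_of smem h) i, app (rel_of smem h) (hsuc i)) \<in> rel_of smem E)"
  (is "?chain \<longleftrightarrow> ?R")
proof -
  have "(\<exists>v. P v \<and> (\<forall>v'. P v' \<longrightarrow> v' = v)) \<longleftrightarrow> (\<exists>!v. P v)" for P :: "'v \<Rightarrow> bool"
    by blast
  then have "?chain \<longleftrightarrow> hyperfinite_seq n h \<and>
     (star (num 0), x) \<in> rel_of smem h \<and> (n, y) \<in> rel_of smem h \<and>
     (\<forall>i v. (i, v) \<in> rel_of smem h \<longrightarrow> smem v Y) \<and>
     (\<forall>i i' v v'. (i, i') \<in> star_rel Sc \<and> (i, v) \<in> rel_of smem h \<and> (i', v') \<in> rel_of smem h \<longrightarrow>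
        (v, v') \<in> rel_of smem E)"
    unfolding is_chain_def hyperfinite_seq_def hle_def
    by (simp add: hypernats_def members_def)
  also have "\<dots> \<longleftrightarrow> ?R"
  proof (rule conj_cong[OF refl])
    assume h: "hyperfinite_seq n h"
    then have n: "hle n n" "hle (star (num 0)) n"
      by (simp_all add: hyperfinite_seq_def hle_refl zero_hle)
    have less: "hless i n \<longleftrightarrow> i \<in> hypernats \<and> hle i n \<and> hle (hsuc i) n" for i
      using hless_iff hless_imp_hle by blast
    show "((star (num 0), x) \<in> rel_of smem h \<and> (n, y) \<in> rel_of smem h \<and>
       (\<forall>i v. (i, v) \<in> rel_of smem h \<longrightarrow> smem v Y) \<and>
       (\<forall>i i' v v'. (i, i') \<in> star_rel Sc \<and> (i, v) \<in> rel_of smem h \<and> (i', v') \<in> rel_of smem h \<longrightarrow>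
          (v, v') \<in> rel_of smem E)) \<longleftrightarrow>
      (app (rel_of smem h) (star (num 0)) = x \<and> app (rel_of smem h) n = y \<and>
       (\<forall>i. hle i n \<longrightarrow> smem (app (rel_of smem h) i) Y) \<and>
       (\<forall>i. hless i n \<longrightarrow>
          (app (rel_of smem h) i, app (rel_of smem h) (hsuc i)) \<in> rel_of smem E))"
      unfolding hyperfinite_seq_rel_iff[OF h] star_rel_Sc less
      by (auto simp: n)
  qed
  finally show ?thesis .
qed

end

section \<open>The comparison map\<close>

locale standard_proper_geodesic_space =
  nonstandard_extension mem smem star + pointed_proper_geodesic_space X d \<xi>
  for mem :: "'u \<Rightarrow> 'u \<Rightarrow> bool" and smem :: "'v \<Rightarrow> 'v \<Rightarrow> bool" and star :: "'u \<Rightarrow> 'v"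
    and X :: "'u set" and d :: "'u \<Rightarrow> 'u \<Rightarrow> real" and \<xi> :: 'u +
  assumes is_standard_space: "is_standard X"
begin

abbreviation "C \<equiv> bounded_coarse X d"

lemma is_standard_rel: "E \<subseteq> X \<times> X \<Longrightarrow> is_standard (pairs E)"
  by (rule is_standard_pairs[OF is_standard_space is_standard_space])

lemma is_standard_far: "is_standard (far n)"
  using is_standard_subset[OF is_standard_space far_subset] .

lemma near_rel_subset: "near_rel k \<subseteq> X \<times> X"
  by (auto simp: near_rel_def)

lemma linked_subset: "linked n \<subseteq> X \<times> X"
  using linked_far far_subset by blast

section \<open>External notions in terms of standard sets and relations\<close>

lemma near_iff: "near C x y \<longleftrightarrow> (\<exists>k. (x, y) \<in> star_rel (near_rel k))"
proof
  assume "near C x y"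
  then obtain E k where "(x, y) \<in> star_rel E" "E \<subseteq> near_rel k"
    using bounded_coarse_near_rel unfolding near_def by auto
  then show "\<exists>k. (x, y) \<in> star_rel (near_rel k)"
    using star_rel_mono[OF is_standard_rel[OF near_rel_subset]] by blast
next
  assume "\<exists>k. (x, y) \<in> star_rel (near_rel k)"
  then show "near C x y"
    unfolding near_def using bounded_coarse_near_rel by blast
qed

text \<open>Points outside \<open>far n\<close> are within \<open>n\<close> of the basepoint, and no
  point of \<open>far k\<close> is within \<open>k\<close> of it. Transferring these two facts gives
  the two directions.\<close>

lemma inf_points_iff: "x \<in> inf_points X C \<xi> \<longleftrightarrow> (\<forall>n. x \<in> star_set (far n))"
proof
  assume x: "x \<in> inf_points X C \<xi>"
  show "\<forall>n. x \<in> star_set (far n)"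
  proof (rule allI, rule ccontr)
    fix n assume n: "x \<notin> star_set (far n)"
    have std: "is_standard (X - far n)"
      by (rule is_standard_subset[OF is_standard_space]) blast
    have "X = far n \<union> (X - far n)"
      using far_subset by blast
    then have "star_set X = star_set (far n) \<union> star_set (X - far n)"
      using star_set_Un is_standard_space by metis
    then have "(x, star \<xi>) \<in> star_rel ((X - far n) \<times> {\<xi>})"
      using x n star_rel_Times[OF std is_standard_singleton[of \<xi>]]
      by (auto simp: inf_points_def star_set_singleton)
    moreover have "(X - far n) \<times> {\<xi>} \<subseteq> near_rel n"
      using basepoint by (auto simp: near_rel_def far_def commute)
    ultimately have "(x, star \<xi>) \<in> star_rel (near_rel n)"
      using star_rel_mono[OF is_standard_rel[OF near_rel_subset]] by blast
    then show False
      using x near_iff by (auto simp: inf_points_def)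
  qed
next
  assume x: "\<forall>n. x \<in> star_set (far n)"
  have "\<not> near C x (star \<xi>)"
  proof
    assume "near C x (star \<xi>)"
    then obtain k where "(x, star \<xi>) \<in> star_rel (near_rel k)"
      unfolding near_iff by blast
    moreover have "(x, star \<xi>) \<in> star_rel (far k \<times> {\<xi>})"
      using x star_rel_Times[OF is_standard_far is_standard_singleton[of \<xi>]]
      by (auto simp: star_set_singleton)
    moreover have "far k \<times> {\<xi>} \<inter> near_rel k = {}"
      by (auto simp: near_rel_def far_def commute)
    moreover have "is_standard (pairs (far k \<times> {\<xi>}))"
      using far_subset basepoint by (intro is_standard_rel) auto
    ultimately show False
      using star_rel_Int[of "far k \<times> {\<xi>}" "near_rel k"] is_standard_rel[OF near_rel_subset]
      by (auto simp: star_rel_empty)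
  qed
  moreover have "x \<in> star_set X"
    using x star_set_mono[OF is_standard_space far_subset] by blast
  ultimately show "x \<in> inf_points X C \<xi>"
    by (simp add: inf_points_def)
qed

text \<open>The whole family of link relations, coded as one element of the universe, so that an
  infinite index can be substituted.\<close>

definition Linked :: "('u \<times> 'u) set" where
  "Linked = {(opair (num n) x, y) |n x y. (x, y) \<in> linked n}"

text \<open>Its extension gives a meaning to lying outside a ball of infinite radius.\<close>

definition Far :: "('u \<times> 'u) set" where
  "Far = {(num n, x) |n x. x \<in> far n}"

lemma is_standard_Linked: "is_standard (pairs Linked)"
proof (rule is_standard_pairs[OF products[OF infinity is_standard_space] is_standard_space])
  show "Linked \<subseteq> pairs (Om \<times> X) \<times> X"
    using linked_subset unfolding Linked_def pairs_def by (force simp: image_iff)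
qed

lemma is_standard_Far: "is_standard (pairs Far)"
  by (rule is_standard_pairs[OF infinity is_standard_space]) (use far_subset in \<open>auto simp: Far_def\<close>)

lemma chain_imp_linked:
  assumes "is_chain mem (code Om) (code_rel Le) (code_rel Sc) (num 0)
    (code_rel (near_rel k)) (code (far (n + k))) h N x y"
  shows "(x, y) \<in> linked n"
proof -
  obtain N f where f: "f 0 = x" "f N = y" "\<And>i. i \<le> N \<Longrightarrow> f i \<in> far (n + k)"
    "\<And>i. i < N \<Longrightarrow> (f i, f (Suc i)) \<in> near_rel k"
    using is_chainE[OF assms]
    unfolding mem_code[OF is_standard_far] rel_of_code_rel[OF is_standard_rel[OF near_rel_subset]]
    by metis
  have "(f 0, f N) \<in> linked n"
  proof (rule linked_funI)
    show "f i \<in> far n" if "i \<le> N" for i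
      using f(3)[OF that] far_antimono[of n "n + k"] by auto
    show "(f i, f (Suc i)) \<in> linked n" if "i < N" for i
      using f(3)[of i] f(3)[of "Suc i"] f(4)[OF that] that
      by (intro near_far_linked[of _ n k]) (auto simp: near_rel_def)
  qed
  then show ?thesis
    using f by simp
qed

text \<open>The range \<open>Y\<close> is quantified and constrained through \<open>Far\<close>,
  because the transferred statement is used at an infinite index, for which no parameter
  \<open>code (far n)\<close> is at hand.\<close>

lemma linked_imp_chain:
  assumes "(x, y) \<in> linked n"
  shows "\<exists>Y h N. (\<forall>z. mem z Y \<longrightarrow> (num n, z) \<in> Far) \<and>
    is_chain mem (code Om) (code_rel Le) (code_rel Sc) (num 0) (code_rel (near_rel 1)) Y h N x y"
proof -
  obtain f N where f: "f 0 = x" "f N = y" "\<And>i. i \<le> N \<Longrightarrow> f i \<in> far n"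
    "\<And>i. i < N \<Longrightarrow> d (f i) (f (Suc i)) \<le> 1"
    using linked_funE[OF assms] by blast
  have "(f i, f (Suc i)) \<in> near_rel 1" if "i < N" for i
    using f(3)[of i] f(3)[of "Suc i"] f(4)[OF that] that far_subset by (auto simp: near_rel_def)
  then obtain h where "is_chain mem (code Om) (code_rel Le) (code_rel Sc) (num 0)
      (code_rel (near_rel 1)) (code (far n)) h (num N) (f 0) (f N)"
    using is_chainI[of "far n" "near_rel 1" N f] is_standard_far is_standard_rel[OF near_rel_subset]
      f(3) by metis
  moreover have "\<forall>z. mem z (code (far n)) \<longrightarrow> (num n, z) \<in> Far"
    using is_standard_far by (auto simp: Far_def)
  ultimately show ?thesis
    using f(1,2) by blast
qed

text \<open>Saturation makes the step size of a chain with nearby steps uniform.\<close>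

lemma iota_rel_imp_star_linked:
  assumes "(x, y) \<in> iota_rel X C \<xi>"
  shows "(x, y) \<in> star_rel (linked n)"
proof -
  obtain N h where h: "hyperfinite_seq N h"
    "app (rel_of smem h) (star (num 0)) = x" "app (rel_of smem h) N = y"
    "\<And>i. hle i N \<Longrightarrow> app (rel_of smem h) i \<in> inf_points X C \<xi>"
    "\<And>i. hless i N \<Longrightarrow> near C (app (rel_of smem h) i) (app (rel_of smem h) (hsuc i))"
    using assms unfolding iota_rel_def by blast
  \<comment> \<open>The indices whose step violates the bound \<open>k\<close> form an internal set:
    comprehension inside \<open>Om\<close> holds in the standard universe for every \<open>h\<close>
    and is transferred.\<close>
  have "\<exists>c. \<forall>i. smem i c \<longleftrightarrow> i \<in> star_set Om \<and> (\<exists>i' v v'. (i, i') \<in> star_rel Sc \<and>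
      (i, v) \<in> rel_of smem h \<and> (i', v') \<in> rel_of smem h \<and> (v, v') \<notin> star_rel (near_rel k))"
      (is "\<exists>c. \<forall>i. ?Q k i c") for k
  proof -
    have "\<forall>h. \<exists>c. \<forall>i. mem i c \<longleftrightarrow> i \<in> Om \<and> (\<exists>i' v v'. (i, i') \<in> Sc \<and>
      (i, v) \<in> rel_of mem h \<and> (i', v') \<in> rel_of mem h \<and> (v, v') \<notin> near_rel k)" (is "\<forall>h. \<exists>c. \<forall>i. _ \<longleftrightarrow> ?P h i")
    proof
      fix h
      have "is_standard {i. ?P h i}"
        by (rule is_standard_subset[OF infinity]) blast
      then show "\<exists>c. \<forall>i. mem i c \<longleftrightarrow> ?P h i"
        by (intro exI[of _ "code {i. ?P h i}"]) simp
    qed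
    then show ?thesis
      using elementary[of "(!) [code Om, code_rel Sc, code_rel (near_rel k)]"
        "All 3 (Ex 4 (All 5 (Iff (Mem 5 4) (Conj (Mem 5 0) (Ex 6 (Ex 7 (Ex 8
           (Conj (Rel 1 5 6) (Conj (Rel 3 5 7) (Conj (Rel 3 6 8) (Neg (Rel 2 7 8))))))))))))"]
        infinity is_standard_Sc is_standard_rel[OF near_rel_subset[of k]]
      by simp
  qed
  then have "\<forall>k. \<exists>c. \<forall>i. ?Q k i c" ..
  from choice[OF this] obtain c where c: "\<forall>k i. ?Q k i (c k)" ..
  note c = c[rule_format]
  have c': "smem i (c k) \<longleftrightarrow> hless i N \<and>
      (app (rel_of smem h) i, app (rel_of smem h) (hsuc i)) \<notin> star_rel (near_rel k)" for i k
    unfolding c star_rel_Sc hyperfinite_seq_rel_iff[OF h(1)]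
    using hless_imp_hle[of i N] by (auto simp: hless_iff hypernats_def)
  \<comment> \<open>Otherwise saturation yields one index whose step violates every standard bound,
    contradicting nearness of its ends.\<close>
  have "\<exists>k. members smem (c k) = {}"
  proof (rule ccontr)
    assume "\<nexists>k. members smem (c k) = {}"
    moreover have "star_rel (near_rel k) \<subseteq> star_rel (near_rel (Suc k))" for k
      by (rule star_rel_mono[OF is_standard_rel[OF near_rel_subset]]) (auto simp: near_rel_def)
    then have "members smem (c (Suc k)) \<subseteq> members smem (c k)" for k
      unfolding members_def c' by blast
    ultimately obtain i where "\<And>k. smem i (c k)"
      using decreasing_saturation[of c] by blast
    then show False
      using h(5) unfolding c' near_iff by blast
  qed
  then obtain k where k: "\<And>i. \<not> smem i (c k)"
    by (auto simp: members_def)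
  \<comment> \<open>Points at infinity are in the extension of every \<open>far m\<close>; choosing
    \<open>far (n + k)\<close> leaves the room that \<open>chain_imp_linked\<close>
    consumes.\<close>
  have "is_chain smem (star (code Om)) (star (code_rel Le)) (star (code_rel Sc)) (star (num 0))
    (star (code_rel (near_rel k))) (star (code (far (n + k)))) h N x y"
    unfolding is_chain_star_iff using h k c' by (simp add: inf_points_iff)
  moreover have "\<forall>h N x y. is_chain mem (code Om) (code_rel Le) (code_rel Sc) (num 0)
    (code_rel (near_rel k)) (code (far (n + k))) h N x y \<longrightarrow> (x, y) \<in> linked n"
    using chain_imp_linked by blast
  then have "\<forall>h N x y. is_chain smem (star (code Om)) (star (code_rel Le)) (star (code_rel Sc))
      (star (num 0)) (star (code_rel (near_rel k))) (star (code (far (n + k)))) h N x y \<longrightarrow>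
    (x, y) \<in> star_rel (linked n)"
    using elementary[of "(!) [code Om, code_rel Le, code_rel Sc, num 0, code_rel (near_rel k),
        code (far (n + k)), undefined, undefined, undefined, undefined, code_rel (linked n)]"
        "All 6 (All 7 (All 8 (All 9 (Imp Chain (Rel 10 8 9)))))"]
      is_standard_rel[OF linked_subset[of n]]
    by simp
  ultimately show ?thesis
    by blast
qed

text \<open>An overspill argument: the internal sets \<open>c n\<close> of indices from
  \<open>n\<close> on at which \<open>x\<close> and \<open>y\<close> are linked decrease and are
  nonempty, because \<open>c n\<close> contains the numeral of \<open>n\<close>. A common element is
  an index above every standard numeral.\<close>

lemma star_linked_imp_iota_rel:
  assumes xy: "\<And>n. (x, y) \<in> star_rel (linked n)"
  shows "(x, y) \<in> iota_rel X C \<xi>"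
proof -
  have "\<forall>n. \<exists>c. \<forall>i. smem i c \<longleftrightarrow> i \<in> star_set Om \<and> (star (num n), i) \<in> star_rel Le \<and>
      (\<exists>p. is_opair smem p i x \<and> (p, y) \<in> star_rel Linked)"
  proof
    fix n
    have "\<forall>x y. \<exists>c. \<forall>i. mem i c \<longleftrightarrow> i \<in> Om \<and> (num n, i) \<in> Le \<and>
      (\<exists>p. is_opair mem p i x \<and> (p, y) \<in> Linked)" (is "\<forall>x y. \<exists>c. \<forall>i. _ \<longleftrightarrow> ?P x y i")
    proof (intro allI)
      fix x y
      have "is_standard {i. ?P x y i}"
        by (rule is_standard_subset[OF infinity]) blast
      then show "\<exists>c. \<forall>i. mem i c \<longleftrightarrow> ?P x y i"
        by (intro exI[of _ "code {i. ?P x y i}"]) simp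
    qed
    then show "\<exists>c. \<forall>i. smem i c \<longleftrightarrow> i \<in> star_set Om \<and> (star (num n), i) \<in> star_rel Le \<and>
        (\<exists>p. is_opair smem p i x \<and> (p, y) \<in> star_rel Linked)"
      using elementary[of "(!) [code Om, code_rel Le, code_rel Linked, num n]"
        "All 4 (All 5 (Ex 6 (All 7 (Iff (Mem 7 6) (Conj (Mem 7 0) (Conj (Rel 1 3 7)
           (Ex 8 (Conj (Opair 8 7 4) (Rel 2 8 5)))))))))"]
        infinity is_standard_Le is_standard_Linked
      by simp
  qed
  from choice[OF this] obtain c where c: "\<forall>n i. smem i (c n) \<longleftrightarrow>
      i \<in> star_set Om \<and> (star (num n), i) \<in> star_rel Le \<and>
      (\<exists>p. is_opair smem p i x \<and> (p, y) \<in> star_rel Linked)" ..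
  note c = c[rule_format]
  have nonempty: "members smem (c n) \<noteq> {}" for n
  proof -
    have "\<forall>x y. (x, y) \<in> linked n \<longrightarrow> (\<exists>p. is_opair mem p (num n) x \<and> (p, y) \<in> Linked)"
      by (auto simp: is_opair_iff Linked_def)
    then have "\<forall>x y. (x, y) \<in> star_rel (linked n) \<longrightarrow>
        (\<exists>p. is_opair smem p (star (num n)) x \<and> (p, y) \<in> star_rel Linked)"
      using elementary[of "(!) [num n, code_rel (linked n), code_rel Linked]"
        "All 3 (All 4 (Imp (Rel 1 3 4) (Ex 5 (Conj (Opair 5 0 3) (Rel 2 5 4)))))"]
        is_standard_rel[OF linked_subset[of n]] is_standard_Linked
      by simp
    then have "smem (star (num n)) (c n)"
      unfolding c using xy[of n] infinity is_standard_Le by auto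
    then show ?thesis
      by (auto simp: members_def)
  qed
  have decreasing: "members smem (c (Suc n)) \<subseteq> members smem (c n)" for n
  proof -
    have "\<forall>i. (num (Suc n), i) \<in> Le \<longrightarrow> (num n, i) \<in> Le"
      by auto
    then have "\<forall>i. (star (num (Suc n)), i) \<in> star_rel Le \<longrightarrow> (star (num n), i) \<in> star_rel Le"
      using elementary[of "(!) [num n, num (Suc n), code_rel Le]"
        "All 3 (Imp (Rel 2 1 3) (Rel 2 0 3))"] is_standard_Le
      by simp
    then show ?thesis
      unfolding members_def c by blast
  qed
  obtain i where i: "\<And>n. smem i (c n)"
    using decreasing_saturation[of c, OF nonempty decreasing] by blast
  then obtain p where p: "is_opair smem p i x" "(p, y) \<in> star_rel Linked"
    unfolding c by blast
  have "\<forall>i x y p. is_opair mem p i x \<and> (p, y) \<in> Linked \<longrightarrow>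
    (\<exists>Y h N. (\<forall>z. mem z Y \<longrightarrow> (i, z) \<in> Far) \<and>
      is_chain mem (code Om) (code_rel Le) (code_rel Sc) (num 0) (code_rel (near_rel 1)) Y h N x y)"
  proof (intro allI impI)
    fix i x y p assume "is_opair mem p i x \<and> (p, y) \<in> Linked"
    then obtain n where "i = num n" "(x, y) \<in> linked n"
      unfolding is_opair_iff Linked_def by auto
    then show "\<exists>Y h N. (\<forall>z. mem z Y \<longrightarrow> (i, z) \<in> Far) \<and>
      is_chain mem (code Om) (code_rel Le) (code_rel Sc) (num 0) (code_rel (near_rel 1)) Y h N x y"
      using linked_imp_chain by blast
  qed
  then have "\<forall>i x y p. is_opair smem p i x \<and> (p, y) \<in> star_rel Linked \<longrightarrow>
    (\<exists>Y h N. (\<forall>z. smem z Y \<longrightarrow> (i, z) \<in> star_rel Far) \<and>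
      is_chain smem (star (code Om)) (star (code_rel Le)) (star (code_rel Sc)) (star (num 0))
        (star (code_rel (near_rel 1))) Y h N x y)"
    \<comment> \<open>The free variables of \<open>Chain\<close> are 0 to 9, so \<open>Far\<close>
      and \<open>Linked\<close> are placed at 10 and 11, and 12 to 14 stand for \<open>i\<close>,
      \<open>p\<close> and \<open>z\<close>.\<close>
    using elementary[of "(!) [code Om, code_rel Le, code_rel Sc, num 0, code_rel (near_rel 1),
        undefined, undefined, undefined, undefined, undefined, code_rel Far, code_rel Linked]"
      "All 12 (All 8 (All 9 (All 13 (Imp (Conj (Opair 13 12 8) (Rel 11 13 9))
         (Ex 5 (Ex 6 (Ex 7 (Conj (All 14 (Imp (Mem 14 5) (Rel 10 12 14))) Chain))))))))"]
      is_standard_Linked is_standard_Far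
    by simp
  then obtain Y h N where Y: "\<And>z. smem z Y \<Longrightarrow> (i, z) \<in> star_rel Far"
    and "is_chain smem (star (code Om)) (star (code_rel Le)) (star (code_rel Sc)) (star (num 0))
      (star (code_rel (near_rel 1))) Y h N x y"
    using p by blast
  then have h: "hyperfinite_seq N h"
    "app (rel_of smem h) (star (num 0)) = x" "app (rel_of smem h) N = y"
    "\<And>i. hle i N \<Longrightarrow> smem (app (rel_of smem h) i) Y"
    "\<And>i. hless i N \<Longrightarrow>
      (app (rel_of smem h) i, app (rel_of smem h) (hsuc i)) \<in> star_rel (near_rel 1)"
    unfolding is_chain_star_iff by simp_all
  have Y_inf: "z \<in> inf_points X C \<xi>" if "smem z Y" for z
    unfolding inf_points_iff
  proof
    fix n
    have "\<forall>i z. (num n, i) \<in> Le \<and> (i, z) \<in> Far \<longrightarrow> z \<in> far n"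
      using far_antimono[of n] by (auto simp: Far_def subset_iff)
    then have "\<forall>i z. (star (num n), i) \<in> star_rel Le \<and> (i, z) \<in> star_rel Far \<longrightarrow> z \<in> star_set (far n)"
      using elementary[of "(!) [num n, code_rel Le, code_rel Far, code (far n)]"
        "All 4 (All 5 (Imp (Conj (Rel 1 0 4) (Rel 2 4 5)) (Mem 5 3)))"]
        is_standard_Le is_standard_Far is_standard_far
      by simp
    then show "z \<in> star_set (far n)"
      using Y[OF that] i c by blast
  qed
  have "hle N N" "hle (star (num 0)) N"
    using h(1) by (simp_all add: hyperfinite_seq_def hle_refl zero_hle)
  then have "x \<in> inf_points X C \<xi>" "y \<in> inf_points X C \<xi>"
    using h(2-4) Y_inf by blast+
  then show ?thesis
    unfolding iota_rel_def using h Y_inf near_iff by blast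
qed

lemma iota_rel_iff: "(x, y) \<in> iota_rel X C \<xi> \<longleftrightarrow> (\<forall>n. (x, y) \<in> star_rel (linked n))"
  using iota_rel_imp_star_linked star_linked_imp_iota_rel by blast

section \<open>Equivalence of points at infinity\<close>

lemma star_linked_sym: "(x, y) \<in> star_rel (linked n) \<Longrightarrow> (y, x) \<in> star_rel (linked n)"
proof -
  have "(linked n)\<inverse> = linked n"
    using linked_sym by auto
  then have "star_rel (linked n) = (star_rel (linked n))\<inverse>"
    using star_rel_converse[OF is_standard_space is_standard_space linked_subset] by metis
  then show "(x, y) \<in> star_rel (linked n) \<Longrightarrow> (y, x) \<in> star_rel (linked n)"
    by blast
qed

lemma star_linked_trans:
  assumes "(x, y) \<in> star_rel (linked n)" "(y, z) \<in> star_rel (linked n)"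
  shows "(x, z) \<in> star_rel (linked n)"
proof -
  have "linked n O linked n \<subseteq> linked n"
    using linked_trans by blast
  then have "star_rel (linked n) O star_rel (linked n) \<subseteq> star_rel (linked n)"
    using star_rel_relcomp[OF is_standard_space is_standard_space is_standard_space
        linked_subset linked_subset]
      star_rel_mono[OF is_standard_rel[OF linked_subset]] by metis
  then show ?thesis
    using assms by blast
qed

lemma star_linked_refl:
  assumes "x \<in> inf_points X C \<xi>"
  shows "(x, x) \<in> star_rel (linked n)"
proof -
  have "Id_on (far n) \<subseteq> linked n"
    using linked_refl by blast
  then have "Id_on (star_set (far n)) \<subseteq> star_rel (linked n)"
    using star_rel_mono[OF is_standard_rel[OF linked_subset]] star_rel_Id_on[OF is_standard_far]
    by metis
  then show ?thesis
    using assms inf_points_iff by blast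
qed

text \<open>Through \<open>iota_rel_iff\<close> the properties are inherited from
  \<open>linked n\<close>; no internal sequence has to be reversed or concatenated.\<close>

lemma equiv_iota_rel: "equiv (inf_points X C \<xi>) (iota_rel X C \<xi>)"
proof (rule equivI)
  show "iota_rel X C \<xi> \<subseteq> inf_points X C \<xi> \<times> inf_points X C \<xi>"
    by (auto simp: iota_rel_def)
  show "refl_on (inf_points X C \<xi>) (iota_rel X C \<xi>)"
    unfolding refl_on_def iota_rel_iff using star_linked_refl by blast
  show "sym (iota_rel X C \<xi>)"
    unfolding sym_def iota_rel_iff using star_linked_sym by blast
  show "trans (iota_rel X C \<xi>)"
    unfolding trans_def iota_rel_iff using star_linked_trans by blast
qed

section \<open>Coarse sequences evaluated at infinite indices\<close>

lemma range_coarse_seq: "s \<in> coarse_seqs X C \<xi> \<Longrightarrow> range s \<subseteq> X"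
  by (simp add: coarse_seqs_iff)

text \<open>The right-hand side does not mention \<open>i\<close> and \<open>j\<close>; the case
  \<open>s = t\<close> is the independence of the infinite index.\<close>

lemma iota_rel_star_seq_iff:
  assumes s: "s \<in> coarse_seqs X C \<xi>" and t: "t \<in> coarse_seqs X C \<xi>"
    and inf: "i \<in> infinite_hypernats" "j \<in> infinite_hypernats"
  shows "(star_seq s i, star_seq t j) \<in> iota_rel X C \<xi> \<longleftrightarrow> coend s t"
proof
  note * = is_standard_space range_coarse_seq[OF s] range_coarse_seq[OF t] linked_subset inf
  show "(star_seq s i, star_seq t j) \<in> iota_rel X C \<xi>" if "coend s t"
    unfolding iota_rel_iff
  proof
    fix n
    obtain m where "\<forall>a\<ge>m. \<forall>b\<ge>m. (s a, t b) \<in> linked n"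
      using \<open>coend s t\<close> unfolding coend_def by blast
    then show "(star_seq s i, star_seq t j) \<in> star_rel (linked n)"
      by (rule star_seq_relI[OF *])
  qed
  show "coend s t" if "(star_seq s i, star_seq t j) \<in> iota_rel X C \<xi>"
    using star_seq_relD[OF *] that iota_rel_iff by (intro coend_frequently[OF s t]) blast
qed

text \<open>By \<open>coend_refl\<close> the value is related to itself, and \<open>iota_rel\<close>
  relates only points at infinity.\<close>

lemma star_seq_inf_points:
  assumes "s \<in> coarse_seqs X C \<xi>" "i \<in> infinite_hypernats"
  shows "star_seq s i \<in> inf_points X C \<xi>"
  using iota_rel_star_seq_iff[OF assms(1,1,2,2)] coend_refl[OF assms(1)] by (auto simp: iota_rel_def)

lemma ex_coarse_seq_iota_rel:
  assumes x: "x \<in> inf_points X C \<xi>" and i: "i \<in> infinite_hypernats"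
  obtains s where "s \<in> coarse_seqs X C \<xi>" "(star_seq s i, x) \<in> iota_rel X C \<xi>"
proof -
  have "\<exists>f. (star f, x) \<in> star_rel (linked n)" for n
  proof -
    obtain F where F: "finite F" "F \<subseteq> far n" "\<forall>y\<in>far (Suc n). \<exists>f\<in>F. (f, y) \<in> linked n"
      using finite_representatives[of n] by blast
    have std: "is_standard F"
      using is_standard_subset[OF is_standard_far F(2)] .
    have "\<forall>y. y \<in> far (Suc n) \<longrightarrow> (\<exists>f. f \<in> F \<and> (f, y) \<in> linked n)"
      using F(3) by blast
    then have "\<forall>y. y \<in> star_set (far (Suc n)) \<longrightarrow> (\<exists>f. f \<in> star_set F \<and> (f, y) \<in> star_rel (linked n))"
      using elementary[of "(!) [code (far (Suc n)), code F, code_rel (linked n)]"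
        "All 3 (Imp (Mem 3 0) (Ex 4 (Conj (Mem 4 1) (Rel 2 4 3))))"]
        std is_standard_far[of "Suc n"] is_standard_rel[OF linked_subset[of n]]
      by simp
    moreover have "x \<in> star_set (far (Suc n))"
      using x by (simp add: inf_points_iff)
    ultimately obtain g where "g \<in> star_set F" "(g, x) \<in> star_rel (linked n)"
      by blast
    then show ?thesis
      \<comment> \<open>Finiteness of \<open>F\<close> forces the representative \<open>g\<close> to
        be the image of a standard point.\<close>
      using star_set_finite[OF F(1) std] by auto
  qed
  then obtain f where f: "\<And>n. (star (f n), x) \<in> star_rel (linked n)"
    by metis
  have f_linked: "(f n, f (Suc n)) \<in> linked n" for n
  proof -
    have "star_rel (linked (Suc n)) \<subseteq> star_rel (linked n)"
      by (intro star_rel_mono is_standard_rel linked_subset linked_antimono) simp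
    then have "(star (f n), star (f (Suc n))) \<in> star_rel (linked n)"
      using f star_linked_sym star_linked_trans by blast
    then show ?thesis
      using is_standard_rel[OF linked_subset] by simp
  qed
  then have fX: "f n \<in> X" for n
    using linked_subset by blast
  obtain s where s: "s \<in> coarse_seqs X C \<xi>" and fs: "\<And>n. \<exists>m. \<forall>a\<ge>m. (f n, s a) \<in> linked n"
    using coarse_seq_of_linked[OF f_linked] by blast
  have "(star_seq s i, x) \<in> star_rel (linked n)" for n
  proof -
    obtain m where "\<And>a. a \<ge> m \<Longrightarrow> (f n, s a) \<in> linked n"
      using fs by blast
    then have "\<forall>a\<ge>m. \<forall>b\<ge>m. (s a, f n) \<in> linked n"
      using linked_sym by blast
    \<comment> \<open>The standard point is treated as a constant sequence so that
      \<open>star_seq_relI\<close> applies.\<close>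
    then have "(star_seq s i, star_seq (\<lambda>_. f n) i) \<in> star_rel (linked n)"
      using fX by (intro star_seq_relI[OF is_standard_space range_coarse_seq[OF s] _ linked_subset i i]) auto
    then have "(star_seq s i, star (f n)) \<in> star_rel (linked n)"
      using i by (simp add: star_seq_const infinite_hypernats_def)
    then show ?thesis
      using f star_linked_trans by blast
  qed
  then show ?thesis
    using that s iota_rel_iff by blast
qed

text \<open>All members of the class of \<open>s\<close> are related by \<open>coend\<close>, so all
  their values at infinite indices give one class; \<open>s\<close> and \<open>i\<close> themselves
  witness that the quantifiers in \<open>omega_map\<close> are not vacuous.\<close>

theorem omega_map_eq:
  assumes s: "s \<in> coarse_seqs X C \<xi>" and i: "i \<in> infinite_hypernats"
  shows "omega_map X C \<xi> (sigma_rel X C \<xi> `` {s}) = iota_rel X C \<xi> `` {star_seq s i}"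
  unfolding omega_map_def
proof (rule the_equality)
  have "iota_rel X C \<xi> `` {star_seq s i} = iota_rel X C \<xi> `` {star_seq t j}"
    if t: "t \<in> sigma_rel X C \<xi> `` {s}" and j: "j \<in> infinite_hypernats" for t j
  proof -
    have "(star_seq s i, star_seq t j) \<in> iota_rel X C \<xi>"
      using t sigma_rel_iff[OF s] iota_rel_star_seq_iff[OF s _ i j] by auto
    then show ?thesis
      using equiv_class_eq[OF equiv_iota_rel] by blast
  qed
  then show "\<forall>t\<in>sigma_rel X C \<xi> `` {s}. \<forall>j\<in>infinite_hypernats.
      iota_rel X C \<xi> `` {star_seq s i} = iota_rel X C \<xi> `` {star_seq t j}"
    by blast
  have "s \<in> sigma_rel X C \<xi> `` {s}"
    using sigma_rel_iff[OF s] s coend_refl by simp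
  then show "q = iota_rel X C \<xi> `` {star_seq s i}"
    if "\<forall>t\<in>sigma_rel X C \<xi> `` {s}. \<forall>j\<in>infinite_hypernats. q = iota_rel X C \<xi> `` {star_seq t j}" for q
    using that i by blast
qed

theorem bij_betw_omega_map: "bij_betw (omega_map X C \<xi>) (coarse_sigma X C \<xi>) (iota X C \<xi>)"
proof (rule bij_betwI')
  obtain i where i: "i \<in> infinite_hypernats"
    using infinite_hypernats_nonempty by blast
  fix c assume "c \<in> coarse_sigma X C \<xi>"
  then obtain s where s: "s \<in> coarse_seqs X C \<xi>" and c: "c = sigma_rel X C \<xi> `` {s}"
    unfolding coarse_sigma_def by (rule quotientE)
  show "omega_map X C \<xi> c \<in> iota X C \<xi>"
    unfolding c omega_map_eq[OF s i] iota_def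
    using star_seq_inf_points[OF s i] by (rule quotientI)
  fix c' assume "c' \<in> coarse_sigma X C \<xi>"
  then obtain t where t: "t \<in> coarse_seqs X C \<xi>" and c': "c' = sigma_rel X C \<xi> `` {t}"
    unfolding coarse_sigma_def by (rule quotientE)
  have "omega_map X C \<xi> c = omega_map X C \<xi> c' \<longleftrightarrow> coend s t"
    unfolding c c' omega_map_eq[OF s i] omega_map_eq[OF t i]
    using eq_equiv_class_iff[OF equiv_iota_rel] star_seq_inf_points s t i
      iota_rel_star_seq_iff[OF s t i i] by blast
  moreover have "c = c'" if "coend s t"
  proof -
    have "u \<in> c \<longleftrightarrow> u \<in> c'" for u
      unfolding c c' using sigma_rel_iff[OF s, of u] sigma_rel_iff[OF t, of u]
        that coend_sym coend_trans by blast
    then show ?thesis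
      by blast
  qed
  ultimately show "omega_map X C \<xi> c = omega_map X C \<xi> c' \<longleftrightarrow> c = c'"
    by blast
next
  obtain i where i: "i \<in> infinite_hypernats"
    using infinite_hypernats_nonempty by blast
  fix q assume "q \<in> iota X C \<xi>"
  then obtain x where x: "x \<in> inf_points X C \<xi>" and q: "q = iota_rel X C \<xi> `` {x}"
    unfolding iota_def by (rule quotientE)
  obtain s where s: "s \<in> coarse_seqs X C \<xi>" "(star_seq s i, x) \<in> iota_rel X C \<xi>"
    using ex_coarse_seq_iota_rel[OF x i] by blast
  have "q = omega_map X C \<xi> (sigma_rel X C \<xi> `` {s})"
    unfolding q omega_map_eq[OF s(1) i] using equiv_class_eq[OF equiv_iota_rel s(2)] by simp
  then show "\<exists>c\<in>coarse_sigma X C \<xi>. q = omega_map X C \<xi> c"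
    unfolding coarse_sigma_def using quotientI[OF s(1)] by blast
qed

end

theorem corollary2p7:
  fixes mem :: "'u \<Rightarrow> 'u \<Rightarrow> bool"
    and smem :: "'v \<Rightarrow> 'v \<Rightarrow> bool"
    and star :: "'u \<Rightarrow> 'v"
    and \<C> :: "('u set \<times> ('u \<times> 'u) set set \<times> 'u) set"
    and X :: "'u set" and C :: "('u \<times> 'u) set set" and \<xi> :: 'u
  assumes "nonstandard_extension mem smem star"
    and "standard_universe.standard_full_subcategory mem \<C>"
    and "(X, C, \<xi>) \<in> \<C>"
    and "proper_geodesic_metrisable X C"
  shows "(\<forall>s \<in> coarse_seqs X C \<xi>. \<forall>i \<in> nonstandard_extension.infinite_hypernats mem smem star.
            nonstandard_extension.omega_map mem smem star X C \<xi> (sigma_rel X C \<xi> `` {s}) =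
            nonstandard_extension.iota_rel mem smem star X C \<xi> ``
              {nonstandard_extension.star_seq mem smem star s i}) \<and>
         bij_betw (nonstandard_extension.omega_map mem smem star X C \<xi>)
           (coarse_sigma X C \<xi>)
           (nonstandard_extension.iota mem smem star X C \<xi>)"
proof -
  interpret nonstandard_extension mem smem star
    by (rule assms(1))
  obtain d where d: "Metric_space X d" "proper_metric X d" "geodesic_metric X d"
    and C: "C = bounded_coarse X d"
    using assms(4) unfolding proper_geodesic_metrisable_def by blast
  have X: "\<xi> \<in> X" "is_standard X"
    using assms(2,3) unfolding standard_full_subcategory_def by auto
  interpret Metric_space X d
    by (rule d(1))
  interpret standard_proper_geodesic_space mem smem star X d \<xi>
    by unfold_locales (use d X in auto)
  show ?thesis
    unfolding C using omega_map_eq bij_betw_omega_map by blast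
qed

end
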